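(* Let $n,m\geq 1$ be integers, let $w\in\mathbb{R}^m$ be a unit vector, let $v\colon\mathbb{R}^n\to\mathbb{R}^m$ be $1$-Lipschitz, and let $A\subset\mathbb{R}^n$ be geodesically convex with respect to the pseudo-metric $d_v^w$. Let $u\colon A\to\mathbb{R}^m$ be a $1$-Lipschitz map such that $v(x)-u(x)\in\mathbb{R}w$ for all $x\in A$. Then there exists a $1$-Lipschitz extension $\tilde{u}\colon\mathbb{R}^n\to\mathbb{R}^m$ of $u$ such that $$\sup\{\lVert v(x)-\tilde{u}(x)\rVert\mid x\in\mathbb{R}^n\}=\sup\{\lVert v(x)-u(x)\rVert\mid x\in A\}.$$
   Context: $1$-Lipschitz is meant with respect to the Euclidean norms; suprema are taken in $[0,\infty]$ with $\sup\emptyset=0$. For a $1$-Lipschitz map $v\colon\mathbb{R}^n\to\mathbb{R}^m$ and a unit vector $w\in\mathbb{R}^m$, and for a path $z\in\mathcal{C}^1([a,b],\mathbb{R}^n)$, put $$\ell_v^w(z)=\int_a^b \sqrt{\lVert\dot{z}(t)\rVert^2-\lVert D(v\circ z)(t)\rVert^2+\langle w,D(v\circ z)(t)\rangle^2}\,dt,$$ where $D(v\circ z)(t)\in\mathbb{R}^m$ is the derivative at $t$ of the Lipschitz curve $v\circ z$, which exists for almost every $t$ by Rademacher's theorem. The pseudo-metric is $d_v^w(x,y)=\inf\{\ell_v^w(z)\mid z\in \mathcal{C}^1([a,b],\mathbb{R}^n),\ z(a)=x,\ z(b)=y\}$. The set $A$ is geodesically convex with respect to $d_v^w$ if for any $x,y\in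 A$ there is a path $z\in\mathcal{C}^1([a,b],\mathbb{R}^n)$ with $z(a)=x$, $z(b)=y$, $z([a,b])\subset A$ and $\ell_v^w(z)=d_v^w(x,y)$. *)

theory Defs
  imports "HOL-Analysis.Analysis"
begin

text \<open>
  Derivatives are taken within the interval, hence one-sided at its endpoints, so that
  the values of \<open>z\<close> outside the interval are irrelevant. (The library's
  \<open>C1_differentiable_on\<close> demands two-sided derivatives at the endpoints.)
\<close>

definition C1_path :: "real \<Rightarrow> real \<Rightarrow> (real \<Rightarrow> 'a::euclidean_space) \<Rightarrow> bool" where
  "C1_path a b z \<longleftrightarrow>
     z differentiable_on {a..b} \<and>
     continuous_on {a..b} (\<lambda>t. vector_derivative z (at t within {a..b}))"

text \<open>
  For Lipschitz \<open>v\<close> and a \<open>C1_path\<close> \<open>z\<close>, the curve \<open>v \<circ> z\<close> is differentiable outside a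
  Lebesgue null set; on that null set \<open>vector_derivative\<close> is an unspecified vector, which does
  not affect the integral.
\<close>

definition path_len ::
  "(real^'n \<Rightarrow> real^'m) \<Rightarrow> real^'m \<Rightarrow> real \<Rightarrow> real \<Rightarrow> (real \<Rightarrow> real^'n) \<Rightarrow> real" where
  "path_len v w a b z =
     integral {a..b} (\<lambda>t.
       sqrt ((norm (vector_derivative z (at t within {a..b})))\<^sup>2
             - (norm (vector_derivative (v \<circ> z) (at t within {a..b})))\<^sup>2
             + (w \<bullet> vector_derivative (v \<circ> z) (at t within {a..b}))\<^sup>2))"

text \<open>
  The parameter interval ranges over all nondegenerate compact intervals. The infimum is over a
  set of reals that is nonempty (segments) and, for 1-Lipschitz \<open>v\<close>, bounded below by 0.
\<close>

definition path_dist :: "(real^'n \<Rightarrow> real^'m) \<Rightarrow> real^'m \<Rightarrow> real^'n \<Rightarrow> real^'n \<Rightarrow> real" where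
  "path_dist v w x y =
     Inf {path_len v w a b z | a b z. a < b \<and> C1_path a b z \<and> z a = x \<and> z b = y}"

definition geodesically_convex ::
  "(real^'n \<Rightarrow> real^'m) \<Rightarrow> real^'m \<Rightarrow> (real^'n) set \<Rightarrow> bool" where
  "geodesically_convex v w A \<longleftrightarrow>
     (\<forall>x\<in>A. \<forall>y\<in>A. \<exists>a b z. a < b \<and> C1_path a b z \<and> z a = x \<and> z b = y \<and>
        z ` {a..b} \<subseteq> A \<and> path_len v w a b z = path_dist v w x y)"

end

theory Submission
  imports Defs
begin

text \<open>
  Put \<open>P x = x - \<langle>w, x\<rangle> w\<close> and \<open>e(x, y) = sqrt (\<bar>x - y\<bar>\<^sup>2 - \<bar>P (v x) - P (v y)\<bar>\<^sup>2)\<close>. A map of the form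
  \<open>P \<circ> v + F w\<close> is 1-Lipschitz iff \<open>\<bar>F x - F y\<bar> \<le> e(x, y)\<close> for all \<open>x\<close>, \<open>y\<close>, so the task is to extend
  the scalar function \<open>\<langle>w, u\<rangle>\<close> under this constraint. Differentiating \<open>u\<close> along a geodesic
  inside \<open>A\<close> gives \<open>\<langle>w, u y\<rangle> - \<langle>w, u x\<rangle> \<le> d(x, y)\<close>, where \<open>d\<close> is the path pseudo-metric; testing \<open>d\<close>
  against polygons gives \<open>d(x, y) \<le> \<Sum> e(x\<^sub>i, x\<^bsub>i+1\<^esub>)\<close> along every chain from \<open>x\<close> to \<open>y\<close>. Hence
  McShane's formula over chains yields an admissible extension \<open>F\<close>. Clipping \<open>F\<close> to
  \<open>[\<langle>w, v\<rangle> - C, \<langle>w, v\<rangle> + C]\<close>, with \<open>C\<close> the supremum over \<open>A\<close>, preserves the constraint because \<open>\<langle>w, v\<rangle>\<close>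
  satisfies it too.
\<close>

section \<open>Lipschitz curves are differentiable almost everywhere\<close>

text \<open>A compact interval is the closed ball about its midpoint whose radius is half its
  length, so this is the Vitali covering theorem for balls, phrased by endpoints. \<open>P\<close>
  carries the slope conditions imposed below.\<close>

lemma vitali_intervals:
  fixes S :: "real set"
  assumes "\<And>x d. x \<in> S \<Longrightarrow> 0 < d \<Longrightarrow> \<exists>s r. s < x \<and> x < r \<and> r - s < d \<and> P s r"
  obtains C :: "(real \<times> real) set"
  where "countable C" "\<And>s r. (s, r) \<in> C \<Longrightarrow> s < r \<and> P s r"
    "disjoint_family_on (\<lambda>(s, r). {s..r}) C"
    "negligible (S - (\<Union>(s, r)\<in>C. {s..r}))"
proof -
  define K where "K = {(s, r). s < r \<and> P s r}"
  define c :: "real \<times> real \<Rightarrow> real" where "c = (\<lambda>(s, r). (s + r) / 2)"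
  define \<rho> :: "real \<times> real \<Rightarrow> real" where "\<rho> = (\<lambda>(s, r). (r - s) / 2)"
  have cb: "cball (c i) (\<rho> i) = (case i of (s, r) \<Rightarrow> {s..r})" for i
    by (cases i) (simp add: c_def \<rho>_def cball_eq_atLeastAtMost field_simps)
  obtain C where C: "countable C" "C \<subseteq> K"
     "pairwise (\<lambda>i j. disjnt (cball (c i) (\<rho> i)) (cball (c j) (\<rho> j))) C"
     "negligible (S - (\<Union>i \<in> C. cball (c i) (\<rho> i)))"
  proof (rule Vitali_covering_theorem_cballs[of K \<rho> S c])
    show "0 < \<rho> i" if "i \<in> K" for i
      using that by (auto simp: K_def \<rho>_def)
    show "\<exists>i. i \<in> K \<and> x \<in> cball (c i) (\<rho> i) \<and> \<rho> i < d" if x: "x \<in> S" and d: "0 < d" for x d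
    proof -
      obtain s r where "s < x" "x < r" "r - s < d" "P s r"
        using assms[OF x d] by blast
      then have "(s, r) \<in> K" "x \<in> cball (c (s, r)) (\<rho> (s, r))" "\<rho> (s, r) < d"
        by (auto simp: K_def cb) (simp add: \<rho>_def)
      then show ?thesis by blast
    qed
  qed
  have "disjoint_family_on (\<lambda>(s, r). {s..r}) C"
    using C(3) by (simp add: pairwise_def disjoint_family_on_def disjnt_def cb)
  with C show ?thesis
    by (intro that[of C]) (auto simp: K_def cb)
qed

text \<open>
  Cover \<open>S\<close> by intervals of slope below \<open>p\<close>, then, inside those, by intervals of slope above \<open>q\<close>.
  The Stieltjes measure \<open>\<mu>\<close> of \<open>G\<close> is monotone on the two unions, so
  \<open>q \<lambda>(S) \<le> \<mu>(inner) \<le> \<mu>(outer) \<le> p (\<lambda>(S) + \<epsilon>)\<close>.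
\<close>
lemma negligible_if_dini_gap:
  fixes G :: "real \<Rightarrow> real"
  assumes mono: "\<And>x y. x \<le> y \<Longrightarrow> G x \<le> G y" and cont: "continuous_on UNIV G"
    and S: "S \<in> sets lebesgue" "bounded S" and pq: "p < q"
    and low: "\<And>x d. x \<in> S \<Longrightarrow> 0 < d \<Longrightarrow>
      \<exists>s r. s < x \<and> x < r \<and> r - s < d \<and> G r - G s < p * (r - s)"
    and high: "\<And>x d. x \<in> S \<Longrightarrow> 0 < d \<Longrightarrow>
      \<exists>s r. s < x \<and> x < r \<and> r - s < d \<and> q * (r - s) < G r - G s"
  shows "negligible S"
proof (cases "S = {}")
  case False
  then obtain x0 where "x0 \<in> S" by blast
  from low[OF this, of 1] obtain s r where "s < x0" "x0 < r" "G r - G s < p * (r - s)" by auto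
  then have sr: "s < r" by linarith
  from \<open>G r - G s < p * (r - s)\<close> have "0 < p * (r - s)" using mono[of s r] sr by linarith
  \<comment> \<open>Monotone \<open>G\<close> has nonnegative increments, so a slope below
    \<open>p\<close> forces \<open>p\<close> to be positive. Hence \<open>ennreal p\<close> and
    \<open>ennreal q\<close> lose nothing, and dividing by \<open>p\<close> is legitimate.\<close>
  then have p: "0 < p" using sr by (simp add: zero_less_mult_iff)
  let ?L = "lebesgue :: real measure"
  let ?M = "interval_measure G"
  let ?I = "\<lambda>(s, r). {s..r} :: real set"
  have L: "emeasure ?L {s..r} = ennreal (r - s)" if "s < r" for s r
    using that by simp
  have M: "emeasure ?M {s..r} = ennreal (G r - G s)" if "s < r" for s r
    using that by (intro emeasure_interval_measure_Icc mono cont) auto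
  have fin: "emeasure ?L S < \<infinity>"
    using S by (metis bounded_set_imp_lmeasurable fmeasurable_def mem_Collect_eq infinity_ennreal_def)
  have main: "ennreal q * emeasure ?L S \<le> ennreal p * emeasure ?L S + ennreal (p * e)"
    if e: "0 < e" for e :: real
  proof -
    obtain U where U: "open U" "S \<subseteq> U" "U - S \<in> lmeasurable" "emeasure ?L (U - S) < ennreal e"
      using sets_lebesgue_outer_open[OF S(1) e] by blast
    have "\<exists>s r. s < x \<and> x < r \<and> r - s < d \<and> G r - G s < p * (r - s) \<and> {s..r} \<subseteq> U"
      if x: "x \<in> S" and d: "0 < d" for x d
    proof -
      obtain h where h: "0 < h" "ball x h \<subseteq> U"
        using U x by (meson open_contains_ball subsetD)
      obtain s r where "s < x" "x < r" "r - s < min d h" "G r - G s < p * (r - s)"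
        using low[OF x, of "min d h"] d h by auto
      moreover have "{s..r} \<subseteq> ball x h"
        using calculation by (auto simp: dist_real_def)
      ultimately show ?thesis using h by fastforce
    qed
    from vitali_intervals[of S "\<lambda>s r. G r - G s < p * (r - s) \<and> {s..r} \<subseteq> U", OF this]
    obtain C where C: "countable C"
      "\<And>s r. (s, r) \<in> C \<Longrightarrow> s < r \<and> G r - G s < p * (r - s) \<and> {s..r} \<subseteq> U"
      "disjoint_family_on ?I C" "negligible (S - (\<Union>c\<in>C. ?I c))"
      by (metis (lifting))
    \<comment> \<open>Dropping the countably many endpoints costs only a null set and makes
      \<open>V\<close> open, so short intervals around points of \<open>S \<inter> V\<close> stay
      inside the first covering.\<close>
    define V where "V = (\<Union>(s, r)\<in>C. {s<..<r})"
    have "open V" unfolding V_def by auto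
    have cnt: "negligible X" if "countable X" for X :: "real set"
      using that by (simp add: countable_imp_null_set_lborel negligible_iff_null_sets null_sets_completionI)
    have SV: "negligible (S - V)"
    proof (rule negligible_subset)
      show "negligible ((S - (\<Union>c\<in>C. ?I c)) \<union> (fst ` C \<union> snd ` C))"
        using C cnt by (intro negligible_Un) auto
      show "S - V \<subseteq> (S - (\<Union>c\<in>C. ?I c)) \<union> (fst ` C \<union> snd ` C)"
        by (force simp: V_def image_iff)
    qed
    have "\<exists>s r. s < x \<and> x < r \<and> r - s < d \<and> q * (r - s) < G r - G s \<and> {s..r} \<subseteq> V"
      if x: "x \<in> S \<inter> V" and d: "0 < d" for x d
    proof -
      obtain h where h: "0 < h" "ball x h \<subseteq> V"
        using \<open>open V\<close> x by (meson open_contains_ball subsetD IntD2)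
      obtain s r where "s < x" "x < r" "r - s < min d h" "q * (r - s) < G r - G s"
        using high[of x "min d h"] x d h by auto
      moreover have "{s..r} \<subseteq> ball x h"
        using calculation by (auto simp: dist_real_def)
      ultimately show ?thesis using h by fastforce
    qed
    from vitali_intervals[of "S \<inter> V" "\<lambda>s r. q * (r - s) < G r - G s \<and> {s..r} \<subseteq> V", OF this]
    obtain D where D: "countable D"
      "\<And>s r. (s, r) \<in> D \<Longrightarrow> s < r \<and> q * (r - s) < G r - G s \<and> {s..r} \<subseteq> V"
      "disjoint_family_on ?I D" "negligible (S \<inter> V - (\<Union>c\<in>D. ?I c))"
      by (metis (lifting))
    have W: "(\<Union>c\<in>X. ?I c) \<in> sets borel" if "countable X" for X
      using that by (intro sets.countable_UN') auto
    have sum: "emeasure N (\<Union>c\<in>X. ?I c) = (\<integral>\<^sup>+c. emeasure N (?I c) \<partial>count_space X)"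
      if "countable X" "disjoint_family_on ?I X" "sets borel \<subseteq> sets N"
      for X and N :: "real measure"
      using that by (intro emeasure_UN_countable) (auto split: prod.splits)
    have bl: "sets borel \<subseteq> sets ?L" by auto
    have bm: "sets borel \<subseteq> sets ?M" by simp
    have nul: "(S - V) \<union> (S \<inter> V - (\<Union>c\<in>D. ?I c)) \<in> null_sets ?L"
      using SV D(4) negligible_Un negligible_iff_null_sets by blast
    have "emeasure ?L S \<le> emeasure ?L ((\<Union>c\<in>D. ?I c) \<union> ((S - V) \<union> (S \<inter> V - (\<Union>c\<in>D. ?I c))))"
      using W[OF D(1)] nul bl by (intro emeasure_mono sets.Un[of "(\<Union>c\<in>D. ?I c)"]) auto
    also have "\<dots> = emeasure ?L (\<Union>c\<in>D. ?I c)"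
      using W[OF D(1)] nul bl by (intro emeasure_Un_null_set) auto
    finally have 1: "emeasure ?L S \<le> emeasure ?L (\<Union>c\<in>D. ?I c)" .
    have "ennreal q * emeasure ?L S \<le> ennreal q * emeasure ?L (\<Union>c\<in>D. ?I c)"
      using 1 by (rule mult_left_mono) simp
    also have "\<dots> = (\<integral>\<^sup>+c. ennreal q * emeasure ?L (?I c) \<partial>count_space D)"
      using D bl by (subst sum) (auto simp: nn_integral_cmult)
    also have "\<dots> \<le> (\<integral>\<^sup>+c. emeasure ?M (?I c) \<partial>count_space D)"
    proof (rule nn_integral_mono)
      fix c assume "c \<in> space (count_space D)"
      then obtain s r where c: "c = (s, r)" "(s, r) \<in> D" by (cases c) auto
      then show "ennreal q * emeasure ?L (?I c) \<le> emeasure ?M (?I c)"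
        using D(2)[OF c(2)] pq p by (simp add: L M ennreal_mult'[symmetric] del: emeasure_lborel_Icc_eq)
          (auto intro!: ennreal_leI)
    qed
    also have "\<dots> = emeasure ?M (\<Union>c\<in>D. ?I c)"
      using D bm by (subst sum) auto
    also have "\<dots> \<le> emeasure ?M (\<Union>c\<in>C. ?I c)"
    proof (rule emeasure_mono)
      show "(\<Union>c\<in>C. ?I c) \<in> sets ?M" using W[OF C(1)] by simp
      have "V \<subseteq> (\<Union>c\<in>C. ?I c)" unfolding V_def by (intro UN_mono) auto
      then show "(\<Union>c\<in>D. ?I c) \<subseteq> (\<Union>c\<in>C. ?I c)" using D(2) by blast
    qed
    also have "\<dots> = (\<integral>\<^sup>+c. emeasure ?M (?I c) \<partial>count_space C)"
      using C bm by (subst sum) auto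
    also have "\<dots> \<le> (\<integral>\<^sup>+c. ennreal p * emeasure ?L (?I c) \<partial>count_space C)"
    proof (rule nn_integral_mono)
      fix c assume "c \<in> space (count_space C)"
      then obtain s r where c: "c = (s, r)" "(s, r) \<in> C" by (cases c) auto
      then show "emeasure ?M (?I c) \<le> ennreal p * emeasure ?L (?I c)"
        using C(2)[OF c(2)] pq p by (simp add: L M ennreal_mult'[symmetric] del: emeasure_lborel_Icc_eq)
    qed
    also have "\<dots> = ennreal p * emeasure ?L (\<Union>c\<in>C. ?I c)"
      using C bl by (subst sum) (auto simp: nn_integral_cmult)
    also have "\<dots> \<le> ennreal p * emeasure ?L (S \<union> (U - S))"
    proof (intro mult_left_mono emeasure_mono)
      show "(\<Union>c\<in>C. ?I c) \<subseteq> S \<union> (U - S)" using C(2) by blast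
      show "S \<union> (U - S) \<in> sets ?L" using U(3) S by (intro sets.Un) (auto simp: fmeasurableD)
    qed simp
    also have "\<dots> \<le> ennreal p * (emeasure ?L S + emeasure ?L (U - S))"
      using U(3) S by (intro mult_left_mono emeasure_subadditive) (auto simp: fmeasurableD)
    also have "\<dots> \<le> ennreal p * (emeasure ?L S + ennreal e)"
      using U(4) by (intro mult_left_mono add_mono) auto
    also have "\<dots> = ennreal p * emeasure ?L S + ennreal (p * e)"
      using p e by (simp add: distrib_left ennreal_mult)
    finally show ?thesis .
  qed
  obtain l where l: "emeasure ?L S = ennreal l" "0 \<le> l"
    using fin by (metis ennreal_cases infinity_ennreal_def less_irrefl)
  have "q * l \<le> p * l"
  proof (rule field_le_epsilon)
    fix e :: real assume "0 < e"
    \<comment> \<open>The error term in \<open>main\<close> is multiplied by \<open>p\<close>, hence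
      the choice \<open>e / p\<close>.\<close>
    then have "ennreal (q * l) \<le> ennreal (p * l + e)"
      using main[of "e / p"] p pq l by (simp add: ennreal_mult[symmetric] ennreal_plus[symmetric] del: ennreal_plus)
    then show "q * l \<le> p * l + e"
      using p l \<open>0 < e\<close> by (subst (asm) ennreal_le_iff) auto
  qed
  then have "l = 0" using pq l by (metis mult_less_cancel_right less_le_not_le order_less_le)
  then show ?thesis
    using l S by (simp add: negligible_iff_null_sets null_sets_def)
qed simp

text \<open>Widen \<open>{s..r}\<close> by \<open>h\<close> on both sides, so that it straddles
  \<open>t\<close> strictly, and let \<open>h\<close> tend to 0. A difference quotient at
  \<open>t\<close> has \<open>t\<close> as an endpoint of its interval, whereas the coverings only
  see intervals with \<open>t\<close> in their interior.\<close>

lemma straddle_closed: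
  fixes g :: "real \<Rightarrow> real"
  assumes cont: "continuous_on UNIV g"
    and *: "\<And>s r. s < t \<Longrightarrow> t < r \<Longrightarrow> r - s < d \<Longrightarrow> g r - g s \<le> c * (r - s)"
    and sr: "s \<le> t" "t \<le> r" "r - s < d"
  shows "g r - g s \<le> c * (r - s)"
proof -
  define k where "k = (\<lambda>h. g (r + h) - g (s - h) - c * (r - s + 2 * h))"
  have "continuous_on UNIV k"
    unfolding k_def by (intro continuous_intros continuous_on_compose2[OF cont]) auto
  then have "(k \<longlongrightarrow> k 0) (at_right 0)"
    by (meson UNIV_I continuous_on_def tendsto_within_subset subset_UNIV)
  moreover have "eventually (\<lambda>h. k h \<le> 0) (at_right 0)"
  proof (rule eventually_at_rightI)
    show "0 < (d - (r - s)) / 2" using sr by simp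
    show "k h \<le> 0" if "h \<in> {0<..<(d - (r - s)) / 2}" for h
      using that sr *[of "s - h" "r + h"] by (simp add: k_def algebra_simps)
  qed
  ultimately have "k 0 \<le> 0" by (intro tendsto_upperbound) auto
  then show ?thesis by (simp add: k_def)
qed

text \<open>If \<open>t\<close> lies in no \<open>E p q\<close> with rational \<open>p < q\<close>,
  then the slopes of \<open>g\<close> over short intervals around \<open>t\<close> cannot oscillate
  across a rational gap, and so they converge. Each \<open>E p q\<close> is null by the covering
  argument, and there are countably many.\<close>

lemma lipschitz_real_differentiable_ae:
  fixes g :: "real \<Rightarrow> real"
  assumes lip: "L-lipschitz_on UNIV g"
  shows "negligible {t. \<not> g differentiable at t}"
proof -
  \<comment> \<open>\<open>H q n\<close> collects the points inside some interval shorter than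
    \<open>1 / Suc n\<close> with slope above \<open>q\<close>; \<open>W p n\<close> does so for
    slope below \<open>p\<close>. As unions of open intervals both are open, so \<open>E p q\<close>
    is a Borel set.\<close>
  define H where "H q n = \<Union>{{s<..<r} |s r. r - s < 1 / real (Suc n) \<and> q * (r - s) < g r - g s}" for q n
  define W where "W p n = \<Union>{{s<..<r} |s r. r - s < 1 / real (Suc n) \<and> g r - g s < p * (r - s)}" for p n
  define E where "E p q = (\<Inter>n. H q n) \<inter> (\<Inter>n. W p n)" for p q
  have oH: "open (H q n)" and oW: "open (W q n)" for q n
    unfolding H_def W_def by (auto intro!: open_Union)
  have small: "\<exists>n. 1 / real (Suc n) < d" if "0 < d" for d :: real
    using that reals_Archimedean[of d] by (simp add: inverse_eq_divide)
  have L0: "0 \<le> L" using lip lipschitz_on_nonneg by blast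
  have gl: "\<bar>g x - g y\<bar> \<le> L * \<bar>x - y\<bar>" for x y
    using lipschitz_onD[OF lip, of x y] by (simp add: dist_real_def)
  have contg: "continuous_on UNIV g"
    using lip by (rule lipschitz_on_continuous_on)
  have Eneg: "negligible (E p q)" if pq: "p < q" for p q
  proof -
    have "negligible (E p q \<inter> ball 0 (real k))" for k
    proof (rule negligible_if_dini_gap)
      \<comment> \<open>Adding \<open>L * x\<close> makes \<open>g\<close> monotone and raises every
        slope by exactly \<open>L\<close>, so the gap between \<open>p\<close> and \<open>q\<close>
        is kept. The ball supplies boundedness.\<close>
      let ?G = "\<lambda>x. g x + L * x"
      show "?G x \<le> ?G y" if "x \<le> y" for x y
        using gl[of x y] that by (simp add: algebra_simps abs_le_iff)
      show "continuous_on UNIV ?G" by (intro continuous_intros contg)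
      have "E p q \<in> sets borel" unfolding E_def using oH oW by auto
      then show "E p q \<inter> ball 0 (real k) \<in> sets lebesgue" by (metis borel_open open_ball sets.Int sets_completionI_sets sets_lborel)
      show "bounded (E p q \<inter> ball 0 (real k))" by (rule bounded_Int) simp
      show "p + L < q + L" using pq by simp
    next
      fix x d :: real assume x: "x \<in> E p q \<inter> ball 0 (real k)" and "0 < d"
      obtain n where n: "1 / real (Suc n) < d" using small \<open>0 < d\<close> by blast
      have "x \<in> W p n" using x by (auto simp: E_def)
      then obtain s r where "s < x" "x < r" "r - s < 1 / real (Suc n)" "g r - g s < p * (r - s)"
        by (auto simp: W_def)
      then show "\<exists>s r. s < x \<and> x < r \<and> r - s < d \<and> g r + L * r - (g s + L * s) < (p + L) * (r - s)"
        using n by (intro exI[of _ s] exI[of _ r]) (auto simp: algebra_simps)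
    next
      fix x d :: real assume x: "x \<in> E p q \<inter> ball 0 (real k)" and "0 < d"
      obtain n where n: "1 / real (Suc n) < d" using small \<open>0 < d\<close> by blast
      have "x \<in> H q n" using x by (auto simp: E_def)
      then obtain s r where "s < x" "x < r" "r - s < 1 / real (Suc n)" "q * (r - s) < g r - g s"
        by (auto simp: H_def)
      then show "\<exists>s r. s < x \<and> x < r \<and> r - s < d \<and> (q + L) * (r - s) < g r + L * r - (g s + L * s)"
        using n by (intro exI[of _ s] exI[of _ r]) (auto simp: algebra_simps)
    qed
    then have "negligible (\<Union>k. E p q \<inter> ball 0 (real k))"
      by (intro negligible_countable_Union) auto
    moreover have "(\<Union>k. E p q \<inter> ball 0 (real k)) = E p q"
      by (auto simp: reals_Archimedean2)
    ultimately show ?thesis by simp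
  qed
  define B where "B = (\<Union>(p, q)\<in>{(p, q). p \<in> \<rat> \<and> q \<in> \<rat> \<and> p < q}. E p q)"
  have "countable {(p, q). p \<in> \<rat> \<and> q \<in> (\<rat> :: real set) \<and> p < q}"
    by (rule countable_subset[of _ "\<rat> \<times> \<rat>"]) (auto intro: countable_rat)
  then have "negligible B" unfolding B_def using Eneg
    by (intro negligible_countable_Union) auto
  moreover have "g differentiable at t" if t: "t \<notin> B" for t
  proof -
    \<comment> \<open>\<open>Q\<close> holds the numbers that bound all slopes over sufficiently
      short intervals around \<open>t\<close> from above. Its infimum, the upper derivative, is the
      candidate for the derivative.\<close>
    define Q where "Q = {q. \<exists>n. t \<notin> H q n}"
    have "t \<notin> H L 0"
    proof
      assume "t \<in> H L 0"
      then obtain s r where "s < t" "t < r" "L * (r - s) < g r - g s" by (auto simp: H_def)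
      then show False using gl[of r s] by auto
    qed
    then have Qne: "Q \<noteq> {}" by (auto simp: Q_def)
    have Qlow: "- L - 1 \<le> q" if "q \<in> Q" for q
    proof (rule ccontr)
      assume q: "\<not> - L - 1 \<le> q"
      have "t \<in> H q n" for n
      proof -
        define h where "h = 1 / real (Suc n) / 4"
        have h: "h > 0" "2 * h < 1 / real (Suc n)" unfolding h_def by (simp_all add: field_simps)
        have "q * (2 * h) < - L * (2 * h)" using q h by (intro mult_strict_right_mono) auto
        also have "\<dots> \<le> g (t + h) - g (t - h)" using gl[of "t + h" "t - h"] h by simp
        finally have "{t - h<..<t + h} \<in> {{s<..<r} |s r. r - s < 1 / real (Suc n) \<and> q * (r - s) < g r - g s}"
          using h by (intro CollectI exI[of _ "t - h"] exI[of _ "t + h"]) auto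
        then show ?thesis using h unfolding H_def by (intro UnionI[of "{t - h<..<t + h}"]) auto
      qed
      then show False using that by (auto simp: Q_def)
    qed
    then have bdd: "bdd_below Q" by (intro bdd_belowI[of Q "- L - 1"])
    define D where "D = Inf Q"
    have "(g has_derivative (*) D) (at t)"
      unfolding has_derivative_at_alt
    proof (intro conjI allI impI)
      fix e :: real assume "0 < e"
      then have "Inf Q < D + e" by (simp add: D_def)
      then obtain q where "q \<in> Q" "q < D + e" using cInf_lessD[OF Qne] by blast
      then obtain n where n: "t \<notin> H q n" by (auto simp: Q_def)
      have up0: "g r - g s \<le> q * (r - s)" if "s < t" "t < r" "r - s < 1 / real (Suc n)" for s r
      proof (rule ccontr)
        assume "\<not> ?thesis"
        then have "{s<..<r} \<in> {{s<..<r} |s r. r - s < 1 / real (Suc n) \<and> q * (r - s) < g r - g s}"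
          using that by (intro CollectI exI[of _ s] exI[of _ r]) auto
        then have "t \<in> H q n"
          using that unfolding H_def by (intro UnionI[of "{s<..<r}"]) auto
        then show False using n by simp
      qed
      \<comment> \<open>Since \<open>q' < Inf Q\<close>, the point \<open>t\<close> lies in every
        \<open>H q' n\<close>. As it avoids \<open>E p q'\<close>, it must miss some
        \<open>W p m\<close>, so slopes at that scale are at least \<open>p > D - e\<close>.\<close>
      obtain q' where q': "q' \<in> \<rat>" "D - e < q'" "q' < D"
        using Rats_dense_in_real[of "D - e" D] \<open>0 < e\<close> by auto
      obtain p where p: "p \<in> \<rat>" "D - e < p" "p < q'"
        using Rats_dense_in_real[OF q'(2)] by auto
      have "q' \<notin> Q" using q' cInf_lower[OF _ bdd, of q'] by (auto simp: D_def)
      moreover have "t \<notin> E p q'" using t p q' by (auto simp: B_def)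
      ultimately obtain m where m: "t \<notin> W p m" by (auto simp: E_def Q_def)
      \<comment> \<open>The lower bound is stated as an upper bound for \<open>- g\<close>, so that
        \<open>straddle_closed\<close> serves both sides.\<close>
      have low0: "- g r - - g s \<le> - p * (r - s)" if "s < t" "t < r" "r - s < 1 / real (Suc m)" for s r
      proof (rule ccontr)
        assume "\<not> ?thesis"
        then have "{s<..<r} \<in> {{s<..<r} |s r. r - s < 1 / real (Suc m) \<and> g r - g s < p * (r - s)}"
          using that by (intro CollectI exI[of _ s] exI[of _ r]) auto
        then have "t \<in> W p m"
          using that unfolding W_def by (intro UnionI[of "{s<..<r}"]) auto
        then show False using m by simp
      qed
      define d where "d = min (1 / real (Suc n)) (1 / real (Suc m))"
      have up: "g r - g s \<le> q * (r - s)" if "s \<le> t" "t \<le> r" "r - s < d" for s r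
        using that by (intro straddle_closed[OF contg up0]) (auto simp: d_def)
      have low: "- g r - - g s \<le> - p * (r - s)" if "s \<le> t" "t \<le> r" "r - s < d" for s r
        using that by (intro straddle_closed[OF continuous_on_minus[OF contg] low0]) (auto simp: d_def)
      have "\<bar>g y - g t - D * (y - t)\<bar> \<le> e * \<bar>y - t\<bar>" if y: "\<bar>y - t\<bar> < d" for y
      proof (cases "t \<le> y")
        case True
        have "q * (y - t) \<le> (D + e) * (y - t)" "(D - e) * (y - t) \<le> p * (y - t)"
          using True p \<open>q < D + e\<close> by (auto intro!: mult_right_mono)
        then show ?thesis using up[of t y] low[of t y] y True by (simp add: algebra_simps abs_le_iff)
      next
        case False
        have "q * (t - y) \<le> (D + e) * (t - y)" "(D - e) * (t - y) \<le> p * (t - y)"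
          using False p \<open>q < D + e\<close> by (auto intro!: mult_right_mono)
        then show ?thesis using up[of y t] low[of y t] y False by (simp add: algebra_simps abs_le_iff)
      qed
      moreover have "d > 0" by (simp add: d_def)
      ultimately show "\<exists>d>0. \<forall>y. norm (y - t) < d \<longrightarrow>
          norm (g y - g t - D * (y - t)) \<le> e * norm (y - t)"
        by (intro exI[of _ d]) simp
    qed (rule bounded_linear_mult_right)
    then show ?thesis unfolding differentiable_def by blast
  qed
  then have "{t. \<not> g differentiable at t} \<subseteq> B" by blast
  ultimately show ?thesis using negligible_subset by blast
qed

lemma lipschitz_differentiable_ae:
  fixes g :: "real \<Rightarrow> 'a::euclidean_space"
  assumes lip: "L-lipschitz_on UNIV g"
  shows "negligible {t. \<not> g differentiable at t}"
proof -
  have "negligible (\<Union>i\<in>Basis. {t. \<not> (\<lambda>x. g x \<bullet> i) differentiable at t})"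
  proof (intro negligible_Union ballI finite_imageI)
    fix X assume "X \<in> (\<lambda>i. {t. \<not> (\<lambda>x. g x \<bullet> i) differentiable at t}) ` Basis"
    then obtain i :: 'a where i: "i \<in> Basis" "X = {t. \<not> (\<lambda>x. g x \<bullet> i) differentiable at t}" by blast
    have "L-lipschitz_on UNIV (\<lambda>x. g x \<bullet> i)"
    proof (rule lipschitz_onI)
      show "dist (g x \<bullet> i) (g y \<bullet> i) \<le> L * dist x y" for x y
      proof -
        have "\<bar>(g x - g y) \<bullet> i\<bar> \<le> norm (g x - g y)" by (rule Basis_le_norm[OF i(1)])
        then show ?thesis
          using lipschitz_onD[OF lip, of x y] by (simp add: dist_norm inner_diff_left)
      qed
    qed (rule lipschitz_on_nonneg[OF lip])
    then show "negligible X" unfolding i(2) by (rule lipschitz_real_differentiable_ae)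
  qed simp
  moreover have "{t. \<not> g differentiable at t} \<subseteq> (\<Union>i\<in>Basis. {t. \<not> (\<lambda>x. g x \<bullet> i) differentiable at t})"
    by (subst differentiable_componentwise_within) auto
  ultimately show ?thesis by (rule negligible_subset)
qed

section \<open>The fundamental theorem of calculus for Lipschitz curves\<close>

lemma has_vector_derivative_quotient_tendsto:
  assumes "(f has_vector_derivative D) (at x within S)"
  shows "((\<lambda>y. (1 / (y - x)) *\<^sub>R (f y - f x)) \<longlongrightarrow> D) (at x within S)"
proof -
  have "((\<lambda>y. norm (f y - f x - (y - x) *\<^sub>R D) / norm (y - x)) \<longlongrightarrow> 0) (at x within S)"
    using assms by (simp add: has_vector_derivative_def has_derivative_iff_norm)
  moreover have "\<forall>\<^sub>F y in at x within S.
      norm (f y - f x - (y - x) *\<^sub>R D) / norm (y - x) = norm ((1 / (y - x)) *\<^sub>R (f y - f x) - D)"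
    unfolding eventually_at_filter
  proof (intro always_eventually allI impI)
    fix y assume "y \<noteq> x"
    then have "(1 / (y - x)) *\<^sub>R (f y - f x) - D = (1 / (y - x)) *\<^sub>R (f y - f x - (y - x) *\<^sub>R D)"
      by (simp add: scaleR_diff_right)
    then show "norm (f y - f x - (y - x) *\<^sub>R D) / norm (y - x) = norm ((1 / (y - x)) *\<^sub>R (f y - f x) - D)"
      by (simp del: scaleR_diff_right scaleR_left_diff_distrib)
  qed
  ultimately have "((\<lambda>y. norm ((1 / (y - x)) *\<^sub>R (f y - f x) - D)) \<longlongrightarrow> 0) (at x within S)"
    by (rule Lim_transform_eventually)
  then show ?thesis
    by (simp add: tendsto_norm_zero_iff LIM_zero_iff)
qed

text \<open>
  The difference quotients are dominated by \<open>L\<close>, and the integral of the \<open>k\<close>-th one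
  telescopes to a difference of averages of \<open>g\<close> near the endpoints.
\<close>
lemma lipschitz_ftc:
  fixes g :: "real \<Rightarrow> 'a::euclidean_space"
  assumes lip: "L-lipschitz_on UNIV g" and ab: "a \<le> b"
  shows "((\<lambda>t. if g differentiable at t then vector_derivative g (at t) else 0)
    has_integral g b - g a) {a..b}"
proof -
  define N where "N = {t. \<not> g differentiable at t}"
  have N: "negligible N" unfolding N_def by (rule lipschitz_differentiable_ae[OF lip])
  have cont: "continuous_on S g" for S
    using lipschitz_on_continuous_on[OF lip] continuous_on_subset by blast
  define h where "h = (\<lambda>k. 1 / real (Suc k))"
  have h: "0 < h k" "h k \<le> 1" "h \<longlonglongrightarrow> 0" for k
    using LIMSEQ_inverse_real_of_nat by (auto simp: h_def divide_simps inverse_eq_divide)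
  define q where "q = (\<lambda>k t. (1 / h k) *\<^sub>R (g (t + h k) - g t))"
  define f where "f = (\<lambda>k t. if t \<in> N then 0 else q k t)"
  define g' where "g' = (\<lambda>t. if t \<in> N then 0 else vector_derivative g (at t))"
  have lim: "(\<lambda>k. (1 / h k) *\<^sub>R (G (x + h k) - G x)) \<longlonglongrightarrow> G'"
    if G: "(G has_vector_derivative G') (at x within S)" and S: "\<And>k. x + h k \<in> S"
    for G :: "real \<Rightarrow> 'a" and G' x S
  proof -
    have "((\<lambda>y. (1 / (y - x)) *\<^sub>R (G y - G x)) \<longlongrightarrow> G') (at x within S)"
      using G by (rule has_vector_derivative_quotient_tendsto)
    moreover have "filterlim (\<lambda>k. x + h k) (at x within S) sequentially"
      using h S by (auto simp: filterlim_at less_imp_neq[symmetric] intro!: tendsto_eq_intros always_eventually)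
    ultimately show ?thesis using filterlim_compose by fastforce
  qed
  \<comment> \<open>Difference quotients of an antiderivative of \<open>g\<close> are
    antiderivatives of the difference quotients \<open>q k\<close>. The interval reaches to
    \<open>b + 1\<close> because the shifts satisfy \<open>h k \<le> 1\<close>.\<close>
  obtain \<Phi> where \<Phi>: "\<And>x. x \<in> {a..b+1} \<Longrightarrow> (\<Phi> has_vector_derivative g x) (at x within {a..b+1})"
    using antiderivative_continuous[OF cont] by blast
  define \<Psi> where "\<Psi> = (\<lambda>k x. (1 / h k) *\<^sub>R (\<Phi> (x + h k) - \<Phi> x))"
  have q_int: "(q k has_integral \<Psi> k b - \<Psi> k a) {a..b}" for k
  proof (rule fundamental_theorem_of_calculus[OF ab])
    fix x assume x: "x \<in> {a..b}"
    have "((\<Phi> \<circ> (\<lambda>x. x + h k)) has_vector_derivative 1 *\<^sub>R g (x + h k)) (at x within {a..b})"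
    proof (rule vector_diff_chain_within)
      show "((\<lambda>x. x + h k) has_vector_derivative 1) (at x within {a..b})"
        by (auto intro!: derivative_eq_intros)
      show "(\<Phi> has_vector_derivative g (x + h k)) (at (x + h k) within (\<lambda>x. x + h k) ` {a..b})"
        using x h(1,2)[of k] by (intro has_vector_derivative_within_subset[OF \<Phi>]) auto
    qed
    moreover have "(\<Phi> has_vector_derivative g x) (at x within {a..b})"
      using x by (intro has_vector_derivative_within_subset[OF \<Phi>]) auto
    ultimately show "(\<Psi> k has_vector_derivative q k x) (at x within {a..b})"
      unfolding \<Psi>_def q_def o_def by (auto intro!: derivative_eq_intros)
  qed
  have f_int: "(f k has_integral \<Psi> k b - \<Psi> k a) {a..b}" for k
    by (rule has_integral_spike[OF N _ q_int]) (auto simp: f_def)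
  have norm: "norm (f k t) \<le> L" for k t
  proof -
    have "norm (g (t + h k) - g t) \<le> L * h k"
      using lipschitz_onD[OF lip, of "t + h k" t] h(1)[of k] by (simp add: dist_norm)
    then show ?thesis
      using h(1)[of k] lipschitz_on_nonneg[OF lip] by (simp add: f_def q_def pos_divide_le_eq)
  qed
  have ptw: "(\<lambda>k. f k t) \<longlonglongrightarrow> g' t" for t
  proof (cases "t \<in> N")
    case False
    then have "(g has_vector_derivative g' t) (at t within UNIV)"
      by (simp add: N_def g'_def vector_derivative_works)
    from lim[OF this] show ?thesis using False by (simp add: f_def q_def)
  qed (simp add: f_def g'_def)
  have "g' integrable_on {a..b}" "(\<lambda>k. integral {a..b} (f k)) \<longlonglongrightarrow> integral {a..b} g'"
    using dominated_convergence[of f "{a..b}" "\<lambda>_. L" g'] f_int norm ptw by (auto simp: integrable_on_def)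
  moreover have "(\<lambda>k. integral {a..b} (f k)) \<longlonglongrightarrow> g b - g a"
  proof -
    have "(\<lambda>k. \<Psi> k x) \<longlonglongrightarrow> g x" if "x \<in> {a..b}" for x
      unfolding \<Psi>_def using that h(1,2) by (intro lim[OF \<Phi>]) (auto intro: add_mono add_increasing2 less_imp_le)
    then have "(\<lambda>k. \<Psi> k b - \<Psi> k a) \<longlonglongrightarrow> g b - g a"
      using ab by (intro tendsto_diff) auto
    moreover have "integral {a..b} (f k) = \<Psi> k b - \<Psi> k a" for k
      using f_int by (rule integral_unique)
    ultimately show ?thesis by simp
  qed
  ultimately have "(g' has_integral g b - g a) {a..b}"
    using LIMSEQ_unique has_integral_integral by metis
  moreover have "g' = (\<lambda>t. if g differentiable at t then vector_derivative g (at t) else 0)"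
    by (auto simp: g'_def N_def)
  ultimately show ?thesis by simp
qed

text \<open>Clamping the parameter to \<open>{a..b}\<close> extends \<open>g\<close> to a Lipschitz
  curve \<open>G\<close> on the whole line. Setting \<open>g'\<close> to 0 on the exceptional set
  lets norm bounds on it hold at every point.\<close>

lemma lipschitz_on_interval_ftc:
  fixes g :: "real \<Rightarrow> 'a::euclidean_space"
  assumes lip: "L-lipschitz_on {a..b} g" and ab: "a < b"
  obtains N g' where "negligible N"
    "\<And>t. t \<in> {a..b} - N \<Longrightarrow> (g has_vector_derivative g' t) (at t within {a..b})"
    "\<And>t. t \<in> N \<Longrightarrow> g' t = 0"
    "(g' has_integral g b - g a) {a..b}"
proof -
  define c where "c = (\<lambda>t. max a (min b t))"
  define G where "G = g \<circ> c"
  define N where "N = {t. \<not> G differentiable at t}"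
  define g' where "g' = (\<lambda>t. if t \<in> N then 0 else vector_derivative G (at t))"
  have c: "c t \<in> {a..b}" for t using ab by (auto simp: c_def)
  have Gg: "G t = g t" if "t \<in> {a..b}" for t using that by (auto simp: G_def c_def)
  have G: "L-lipschitz_on UNIV G"
  proof (rule lipschitz_onI)
    show "dist (G x) (G y) \<le> L * dist x y" for x y
    proof -
      have "dist (c x) (c y) \<le> dist x y" by (auto simp: c_def dist_real_def)
      then show ?thesis using lipschitz_onD[OF lip c c, of x y] lipschitz_on_nonneg[OF lip]
        unfolding G_def o_def by (meson mult_left_mono order_trans)
    qed
  qed (rule lipschitz_on_nonneg[OF lip])
  show ?thesis
  proof (rule that[of N g'])
    show "negligible N" unfolding N_def by (rule lipschitz_differentiable_ae[OF G])
    show "(g has_vector_derivative g' t) (at t within {a..b})" if "t \<in> {a..b} - N" for t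
    proof -
      have "(G has_vector_derivative g' t) (at t)"
        using that by (auto simp: N_def g'_def vector_derivative_works)
      then have "(G has_vector_derivative g' t) (at t within {a..b})"
        by (rule has_vector_derivative_at_within)
      then show ?thesis
        using that by (elim has_vector_derivative_transform[rotated 2]) (auto simp: Gg)
    qed
    show "g' t = 0" if "t \<in> N" for t using that by (simp add: g'_def)
    have "g' = (\<lambda>t. if G differentiable at t then vector_derivative G (at t) else 0)"
      by (auto simp: g'_def N_def)
    then show "(g' has_integral g b - g a) {a..b}"
      using lipschitz_ftc[OF G, of a b] ab by (simp add: Gg)
  qed
qed

section \<open>The length functional\<close>

text \<open>For a unit vector \<open>w\<close> this is the orthogonal projection onto the complement
  of \<open>w\<close>. By Pythagoras the radicand in \<open>path_len\<close> is then the squared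
  speed of \<open>z\<close> minus the squared norm of the projected derivative of
  \<open>v \<circ> z\<close>.\<close>

definition perp :: "'a::real_inner \<Rightarrow> 'a \<Rightarrow> 'a" where
  "perp w x = x - (w \<bullet> x) *\<^sub>R w"

lemma bounded_linear_perp: "bounded_linear (perp w)"
  unfolding perp_def
  by (intro bounded_linear_sub bounded_linear_ident bounded_linear_scaleR_const bounded_linear_inner_right)

lemma perp_diff: "perp w (x - y) = perp w x - perp w y"
  by (rule linear_diff[OF bounded_linear.linear[OF bounded_linear_perp]])

lemma norm_perp:
  assumes "norm w = 1"
  shows "(norm (perp w x))\<^sup>2 = (norm x)\<^sup>2 - (w \<bullet> x)\<^sup>2"
proof -
  have "w \<bullet> w = 1" using assms by (simp add: norm_eq_sqrt_inner)
  then show ?thesis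
    unfolding perp_def power2_norm_eq_inner
    by (simp add: inner_diff_left inner_diff_right inner_commute power2_eq_square algebra_simps)
qed

lemma norm_perp_le:
  assumes "norm w = 1"
  shows "norm (perp w x) \<le> norm x"
  by (rule power2_le_imp_le) (simp_all add: norm_perp[OF assms])

lemma perp_eq_if_diff_in_span:
  assumes "norm w = 1" "x - y \<in> span {w}"
  shows "perp w x = perp w y"
proof -
  obtain k where k: "x - y = k *\<^sub>R w" using assms(2) by (auto simp: span_singleton)
  have "w \<bullet> w = 1" using assms by (simp add: norm_eq_sqrt_inner)
  then have "perp w (x - y) = 0" unfolding k by (simp add: perp_def)
  then show ?thesis by (simp add: perp_diff)
qed

section \<open>Continuously differentiable paths and their images under Lipschitz maps\<close>

lemma C1_path_has_vector_derivative:
  assumes "C1_path a b z" "t \<in> {a..b}"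
  shows "(z has_vector_derivative vector_derivative z (at t within {a..b})) (at t within {a..b})"
  using assms by (auto simp: C1_path_def differentiable_on_def vector_derivative_works)

lemma C1_path_lipschitz:
  fixes z :: "real \<Rightarrow> 'a::euclidean_space"
  assumes "C1_path a b z"
  obtains B where "B-lipschitz_on {a..b} z"
    "\<And>t. t \<in> {a..b} \<Longrightarrow> norm (vector_derivative z (at t within {a..b})) \<le> B"
proof -
  let ?\<zeta> = "\<lambda>t. vector_derivative z (at t within {a..b})"
  have "compact (?\<zeta> ` {a..b})"
    using assms by (intro compact_continuous_image) (auto simp: C1_path_def)
  then have "bounded (?\<zeta> ` {a..b})" by (rule compact_imp_bounded)
  then obtain B where "B > 0" "\<forall>x\<in>?\<zeta> ` {a..b}. norm x \<le> B" unfolding bounded_pos by blast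
  then have B: "B > 0" "\<And>t. t \<in> {a..b} \<Longrightarrow> norm (?\<zeta> t) \<le> B" by auto
  have "B-lipschitz_on {a..b} z"
  proof (rule bounded_derivative_imp_lipschitz)
    show "(z has_derivative (\<lambda>h. h *\<^sub>R ?\<zeta> t)) (at t within {a..b})" if "t \<in> {a..b}" for t
      using C1_path_has_vector_derivative[OF assms that] by (simp add: has_vector_derivative_def)
    show "onorm (\<lambda>h. h *\<^sub>R ?\<zeta> t) \<le> B" if "t \<in> {a..b}" for t
      using B(2)[OF that] by (simp add: onorm_scaleR_left onorm_id)
  qed (use B in auto)
  with B that show ?thesis by blast
qed

text \<open>The curve \<open>v \<circ> z\<close> is again Lipschitz, and its difference quotients
  are no longer than those of \<open>z\<close>. The domain \<open>A\<close> is kept general so that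
  the lemma serves both \<open>v\<close> on the whole space and \<open>u\<close> on its smaller
  domain.\<close>

lemma lipschitz_image_C1_path:
  fixes v :: "'a::euclidean_space \<Rightarrow> 'b::euclidean_space"
  assumes ab: "a < b" and z: "C1_path a b z" and v: "1-lipschitz_on A v" and zA: "z ` {a..b} \<subseteq> A"
  obtains N v' where "negligible N"
    "\<And>t. t \<in> {a..b} - N \<Longrightarrow> (v \<circ> z has_vector_derivative v' t) (at t within {a..b})"
    "\<And>t. t \<in> {a..b} \<Longrightarrow> norm (v' t) \<le> norm (vector_derivative z (at t within {a..b}))"
    "(v' has_integral v (z b) - v (z a)) {a..b}"
proof -
  let ?\<zeta> = "\<lambda>t. vector_derivative z (at t within {a..b})"
  obtain B where "B-lipschitz_on {a..b} z" using C1_path_lipschitz[OF z] by blast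
  then have "(1 * B)-lipschitz_on {a..b} (v \<circ> z)"
    using lipschitz_on_compose lipschitz_on_subset[OF v zA] by blast
  then obtain N v' where N: "negligible N"
    "\<And>t. t \<in> {a..b} - N \<Longrightarrow> (v \<circ> z has_vector_derivative v' t) (at t within {a..b})"
    "\<And>t. t \<in> N \<Longrightarrow> v' t = 0"
    "(v' has_integral (v \<circ> z) b - (v \<circ> z) a) {a..b}"
    by (rule lipschitz_on_interval_ftc[OF _ ab]) (rule that)
  have le: "norm (v' t) \<le> norm (?\<zeta> t)" if t: "t \<in> {a..b}" for t
  proof (cases "t \<in> N")
    case False
    let ?F = "at t within {a..b}"
    have 1: "((\<lambda>y. norm ((1 / (y - t)) *\<^sub>R (z y - z t))) \<longlongrightarrow> norm (?\<zeta> t)) ?F"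
      by (intro tendsto_norm has_vector_derivative_quotient_tendsto C1_path_has_vector_derivative[OF z t])
    have 2: "((\<lambda>y. norm ((1 / (y - t)) *\<^sub>R ((v \<circ> z) y - (v \<circ> z) t))) \<longlongrightarrow> norm (v' t)) ?F"
      using t False by (intro tendsto_norm has_vector_derivative_quotient_tendsto[OF N(2)]) simp
    have 3: "\<forall>\<^sub>F y in ?F. norm ((1 / (y - t)) *\<^sub>R ((v \<circ> z) y - (v \<circ> z) t))
        \<le> norm ((1 / (y - t)) *\<^sub>R (z y - z t))"
      unfolding eventually_at_filter
    proof (intro always_eventually allI impI)
      fix y assume "y \<in> {a..b}"
      then have "z y \<in> A" "z t \<in> A" using zA t by auto
      then have "norm (v (z y) - v (z t)) \<le> norm (z y - z t)"
        using lipschitz_onD[OF v, of "z y" "z t"] by (simp add: dist_norm)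
      then show "norm ((1 / (y - t)) *\<^sub>R ((v \<circ> z) y - (v \<circ> z) t)) \<le> norm ((1 / (y - t)) *\<^sub>R (z y - z t))"
        unfolding norm_scaleR o_def by (intro mult_left_mono) auto
    qed
    have 4: "?F \<noteq> bot" using ab t by (simp add: trivial_limit_within)
    show ?thesis by (rule tendsto_le[OF 4 1 2 3])
  qed (simp add: N(3))
  show ?thesis
    by (rule that[OF N(1,2) le]) (use N(4) in simp_all)
qed

section \<open>Integrability and sign of the length integrand\<close>

definition path_speed ::
  "(real^'n \<Rightarrow> real^'m) \<Rightarrow> real^'m \<Rightarrow> real \<Rightarrow> real \<Rightarrow> (real \<Rightarrow> real^'n) \<Rightarrow> real \<Rightarrow> real" where
  "path_speed v w a b z t =
     sqrt ((norm (vector_derivative z (at t within {a..b})))\<^sup>2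
           - (norm (vector_derivative (v \<circ> z) (at t within {a..b})))\<^sup>2
           + (w \<bullet> vector_derivative (v \<circ> z) (at t within {a..b}))\<^sup>2)"

text \<open>Integrability is the content, since \<open>integral\<close> is a mere default value
  otherwise. The integrand is measurable because \<open>v'\<close> is integrable and
  \<open>z\<close> has a continuous derivative, and a bound for that derivative bounds it. The two
  integrands differ only on the null set \<open>N\<close> inside the interval.\<close>

lemma path_len_has_integral:
  fixes v :: "real^'n \<Rightarrow> real^'m"
  assumes w: "norm w = 1" and ab: "a < b" and z: "C1_path a b z"
    and N: "negligible N"
      "\<And>t. t \<in> {a..b} - N \<Longrightarrow> (v \<circ> z has_vector_derivative v' t) (at t within {a..b})"
      "\<And>t. t \<in> {a..b} \<Longrightarrow> norm (v' t) \<le> norm (vector_derivative z (at t within {a..b}))"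
      "v' integrable_on {a..b}"
  shows "((\<lambda>t. sqrt ((norm (vector_derivative z (at t within {a..b})))\<^sup>2 - (norm (perp w (v' t)))\<^sup>2))
      has_integral path_len v w a b z) {a..b}"
    and "(path_speed v w a b z has_integral path_len v w a b z) {a..b}"
proof -
  let ?\<zeta> = "\<lambda>t. vector_derivative z (at t within {a..b})"
  let ?I = "\<lambda>t. sqrt ((norm (?\<zeta> t))\<^sup>2 - (norm (perp w (v' t)))\<^sup>2)"
  obtain B where B: "B-lipschitz_on {a..b} z" "\<And>t. t \<in> {a..b} \<Longrightarrow> norm (?\<zeta> t) \<le> B"
    by (rule C1_path_lipschitz[OF z]) (rule that)
  have "?I integrable_on {a..b}"
  proof (rule measurable_bounded_by_integrable_imp_integrable)
    have "(perp w \<circ> v') integrable_on {a..b}"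
      by (rule integrable_linear[OF N(4) bounded_linear_perp])
    then have [measurable]: "(\<lambda>t. perp w (v' t)) \<in> borel_measurable (lebesgue_on {a..b})"
      unfolding o_def by (rule integrable_imp_measurable)
    have "continuous_on {a..b} ?\<zeta>" using z by (simp add: C1_path_def)
    then have [measurable]: "?\<zeta> \<in> borel_measurable (lebesgue_on {a..b})"
      by (rule continuous_imp_measurable_on_sets_lebesgue) simp
    show "?I \<in> borel_measurable (lebesgue_on {a..b})"
      by measurable
    show "(\<lambda>_. B) integrable_on {a..b}" by auto
    show "norm (?I t) \<le> B" if t: "t \<in> {a..b}" for t
    proof -
      have "norm (perp w (v' t)) \<le> norm (?\<zeta> t)"
        using norm_perp_le[OF w] N(3)[OF t] order_trans by blast
      then have "0 \<le> ?I t" by (simp add: power_mono)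
      moreover have "?I t \<le> norm (?\<zeta> t)" by (rule real_le_lsqrt) simp_all
      ultimately show ?thesis using B(2)[OF t] unfolding real_norm_def by linarith
    qed
    show "{a..b} \<in> sets lebesgue" by simp
  qed
  then obtain l where l: "(?I has_integral l) {a..b}" by (auto simp: integrable_on_def)
  have *: "(path_speed v w a b z has_integral l) {a..b}"
  proof (rule has_integral_spike[OF N(1) _ l])
    fix t assume t: "t \<in> {a..b} - N"
    then have "vector_derivative (v \<circ> z) (at t within {a..b}) = v' t"
      using vector_derivative_within_closed_interval[OF ab _ N(2)[OF t]] by auto
    then show "path_speed v w a b z t = ?I t"
      by (simp add: path_speed_def norm_perp[OF w])
  qed
  then have "path_len v w a b z = l"
    unfolding path_len_def path_speed_def[abs_def] by (rule integral_unique)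
  with l * show "(?I has_integral path_len v w a b z) {a..b}"
    "(path_speed v w a b z has_integral path_len v w a b z) {a..b}" by auto
qed

lemma path_speed_has_integral:
  fixes v :: "real^'n \<Rightarrow> real^'m"
  assumes w: "norm w = 1" and ab: "a < b" and z: "C1_path a b z" and v: "1-lipschitz_on UNIV v"
  shows "(path_speed v w a b z has_integral path_len v w a b z) {a..b}"
  by (rule lipschitz_image_C1_path[OF ab z v subset_UNIV])
    (rule path_len_has_integral(2)[OF w ab z _ _ _ has_integral_integrable])

text \<open>Makes the infimum in \<open>path_dist\<close> one over a set bounded below. The form
  with \<open>v'\<close> is used because its radicand is nonnegative at every \<open>t\<close>,
  while \<open>path_speed\<close> involves unspecified derivatives on a null set.\<close>

lemma path_len_nonneg:
  fixes v :: "real^'n \<Rightarrow> real^'m"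
  assumes w: "norm w = 1" and ab: "a < b" and z: "C1_path a b z" and v: "1-lipschitz_on UNIV v"
  shows "0 \<le> path_len v w a b z"
proof -
  obtain N v' where N: "negligible N" 
    "\<And>t. t \<in> {a..b} - N \<Longrightarrow> (v \<circ> z has_vector_derivative v' t) (at t within {a..b})"
    and le: "\<And>t. t \<in> {a..b} \<Longrightarrow> norm (v' t) \<le> norm (vector_derivative z (at t within {a..b}))"
    and int: "(v' has_integral v (z b) - v (z a)) {a..b}"
    by (rule lipschitz_image_C1_path[OF ab z v subset_UNIV]) (rule that)
  show ?thesis
  proof (rule has_integral_nonneg[OF path_len_has_integral(1)[OF w ab z N le]])
    show "0 \<le> sqrt ((norm (vector_derivative z (at t within {a..b})))\<^sup>2 - (norm (perp w (v' t)))\<^sup>2)"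
      if "t \<in> {a..b}" for t
    proof -
      have "norm (perp w (v' t)) \<le> norm (vector_derivative z (at t within {a..b}))"
        using norm_perp_le[OF w] le[OF that] by (rule order_trans)
      then show ?thesis by (simp add: power_mono)
    qed
    show "v' integrable_on {a..b}" using int by (rule has_integral_integrable)
  qed
qed

text \<open>Inside \<open>A\<close> the projections of \<open>u \<circ> z\<close> and
  \<open>v \<circ> z\<close> coincide, hence so do those of their derivatives almost everywhere.
  Since \<open>u'\<close> is no longer than the derivative of \<open>z\<close>, Pythagoras bounds
  \<open>w \<bullet> u' t\<close> by the integrand of the length.\<close>

lemma inner_diff_le_path_len:
  fixes u v :: "real^'n \<Rightarrow> real^'m"
  assumes w: "norm w = 1" and ab: "a < b" and z: "C1_path a b z" and zA: "z ` {a..b} \<subseteq> A"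
    and v: "1-lipschitz_on UNIV v" and u: "1-lipschitz_on A u"
    and uv: "\<And>x. x \<in> A \<Longrightarrow> perp w (v x) = perp w (u x)"
  shows "w \<bullet> u (z b) - w \<bullet> u (z a) \<le> path_len v w a b z"
proof -
  let ?\<zeta> = "\<lambda>t. vector_derivative z (at t within {a..b})"
  obtain N v' where N: "negligible N"
    "\<And>t. t \<in> {a..b} - N \<Longrightarrow> (v \<circ> z has_vector_derivative v' t) (at t within {a..b})"
    "\<And>t. t \<in> {a..b} \<Longrightarrow> norm (v' t) \<le> norm (?\<zeta> t)"
    and vint: "(v' has_integral v (z b) - v (z a)) {a..b}"
    by (rule lipschitz_image_C1_path[OF ab z v subset_UNIV]) (rule that)
  obtain M u' where M: "negligible M"
    "\<And>t. t \<in> {a..b} - M \<Longrightarrow> (u \<circ> z has_vector_derivative u' t) (at t within {a..b})"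
    "\<And>t. t \<in> {a..b} \<Longrightarrow> norm (u' t) \<le> norm (?\<zeta> t)"
    and uint: "(u' has_integral u (z b) - u (z a)) {a..b}"
    by (rule lipschitz_image_C1_path[OF ab z u zA]) (rule that)
  let ?I = "\<lambda>t. sqrt ((norm (?\<zeta> t))\<^sup>2 - (norm (perp w (v' t)))\<^sup>2)"
  have I: "(?I has_integral path_len v w a b z) {a..b}"
    using path_len_has_integral(1)[OF w ab z N] vint by blast
  have le: "w \<bullet> u' t \<le> ?I t" if t: "t \<in> {a..b} - (N \<union> M)" for t
  proof -
    have "(perp w \<circ> (v \<circ> z) has_vector_derivative perp w (v' t)) (at t within {a..b})"
      "(perp w \<circ> (u \<circ> z) has_vector_derivative perp w (u' t)) (at t within {a..b})"
      using N(2) M(2) t unfolding o_def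
      by (auto intro!: bounded_linear.has_vector_derivative[OF bounded_linear_perp])
    moreover have "(perp w \<circ> (u \<circ> z)) s = (perp w \<circ> (v \<circ> z)) s" if "s \<in> {a..b}" for s
      using uv[of "z s"] zA that by (simp add: image_subset_iff)
    ultimately have "(perp w \<circ> (v \<circ> z) has_vector_derivative perp w (v' t)) (at t within {a..b})"
      "(perp w \<circ> (v \<circ> z) has_vector_derivative perp w (u' t)) (at t within {a..b})"
      using t by (auto elim!: has_vector_derivative_transform[rotated 2])
    then have "perp w (u' t) = perp w (v' t)"
      using t ab by (intro vector_derivative_unique_within[of t "{a..b}"]) (auto simp: trivial_limit_within)
    then have "(w \<bullet> u' t)\<^sup>2 = (norm (u' t))\<^sup>2 - (norm (perp w (v' t)))\<^sup>2"
      using norm_perp[OF w, of "u' t"] by simp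
    also have "\<dots> \<le> (norm (?\<zeta> t))\<^sup>2 - (norm (perp w (v' t)))\<^sup>2"
      using M(3)[of t] t by (simp add: power_mono)
    finally show ?thesis by (rule real_le_rsqrt)
  qed
  have "((\<lambda>t. w \<bullet> u' t) has_integral w \<bullet> (u (z b) - u (z a))) {a..b}"
    using has_integral_linear[OF uint bounded_linear_inner_right[of w]] by (simp add: o_def)
  then have "((\<lambda>t. if t \<in> N \<union> M then 0 else w \<bullet> u' t) has_integral w \<bullet> (u (z b) - u (z a))) {a..b}"
    by (rule has_integral_spike[OF negligible_Un[OF N(1) M(1)], rotated]) auto
  moreover have "((\<lambda>t. if t \<in> N \<union> M then 0 else ?I t) has_integral path_len v w a b z) {a..b}"
    by (rule has_integral_spike[OF negligible_Un[OF N(1) M(1)] _ I]) auto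
  ultimately have "w \<bullet> (u (z b) - u (z a)) \<le> path_len v w a b z"
    by (rule has_integral_le) (use le in auto)
  then show ?thesis by (simp add: inner_diff_right)
qed

text \<open>This is the reversed inequality for causal vectors of a Lorentzian form. With norms in
  place of the inner product, the squared sides differ by the square of
  \<open>c * norm b - norm B * a\<close>; ordinary Cauchy-Schwarz does the rest.\<close>

lemma reverse_Cauchy_Schwarz:
  fixes B b :: "'a::real_inner"
  assumes "norm B \<le> c" "norm b \<le> a"
  shows "sqrt (c\<^sup>2 - (norm B)\<^sup>2) * sqrt (a\<^sup>2 - (norm b)\<^sup>2) \<le> c * a - B \<bullet> b"
proof -
  have "norm B * norm b \<le> c * a"
    using assms order_trans[OF norm_ge_zero assms(1)] by (intro mult_mono) simp_all
  moreover have "(c\<^sup>2 - (norm B)\<^sup>2) * (a\<^sup>2 - (norm b)\<^sup>2) \<le> (c * a - norm B * norm b)\<^sup>2"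
    using zero_le_power2[of "c * norm b - norm B * a"] by (simp add: power2_eq_square algebra_simps)
  ultimately have "sqrt ((c\<^sup>2 - (norm B)\<^sup>2) * (a\<^sup>2 - (norm b)\<^sup>2)) \<le> c * a - norm B * norm b"
    by (intro real_le_lsqrt) auto
  then show ?thesis
    using norm_cauchy_schwarz[of B b] by (simp add: real_sqrt_mult)
qed

text \<open>
  With \<open>L\<close> the length of the segment and \<open>B\<close> the increment of \<open>perp w \<circ> v\<close>, integrate the reverse
  Cauchy-Schwarz inequality with \<open>c = L + \<epsilon>\<close>; the \<open>\<epsilon>\<close> covers the degenerate case \<open>norm B = L\<close>.
\<close>
lemma path_len_le_if_minimizing:
  fixes v :: "real^'n \<Rightarrow> real^'m"
  assumes w: "norm w = 1" and ab: "a < b" and z: "C1_path a b z" and v: "1-lipschitz_on UNIV v"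
    and minimizing: "((\<lambda>t. norm (vector_derivative z (at t within {a..b}))) has_integral norm (z b - z a)) {a..b}"
  shows "path_len v w a b z \<le> sqrt ((norm (z b - z a))\<^sup>2 - (norm (perp w (v (z b) - v (z a))))\<^sup>2)"
proof -
  let ?\<zeta> = "\<lambda>t. vector_derivative z (at t within {a..b})"
  obtain N v' where N: "negligible N"
    "\<And>t. t \<in> {a..b} - N \<Longrightarrow> (v \<circ> z has_vector_derivative v' t) (at t within {a..b})"
    "\<And>t. t \<in> {a..b} \<Longrightarrow> norm (v' t) \<le> norm (?\<zeta> t)"
    and vint: "(v' has_integral v (z b) - v (z a)) {a..b}"
    by (rule lipschitz_image_C1_path[OF ab z v subset_UNIV]) (rule that)
  let ?I = "\<lambda>t. sqrt ((norm (?\<zeta> t))\<^sup>2 - (norm (perp w (v' t)))\<^sup>2)"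
  have I: "(?I has_integral path_len v w a b z) {a..b}"
    using path_len_has_integral(1)[OF w ab z N] vint by blast
  define L where "L = norm (z b - z a)"
  define B where "B = perp w (v (z b) - v (z a))"
  have BL: "norm B \<le> L"
    using norm_perp_le[OF w, of "v (z b) - v (z a)"] lipschitz_onD[OF v, of "z b" "z a"]
    by (simp add: B_def L_def dist_norm)
  have main: "path_len v w a b z \<le> sqrt ((L + e)\<^sup>2 - (norm B)\<^sup>2)" if e: "0 < e" for e
  proof -
    define s where "s = sqrt ((L + e)\<^sup>2 - (norm B)\<^sup>2)"
    have lt: "(norm B)\<^sup>2 < (L + e)\<^sup>2" using BL e by (intro power_strict_mono) auto
    then have s: "0 < s" "s\<^sup>2 = (L + e)\<^sup>2 - (norm B)\<^sup>2" by (auto simp: s_def)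
    have "((\<lambda>t. perp w (v' t)) has_integral B) {a..b}"
      using has_integral_linear[OF vint bounded_linear_perp] by (simp add: o_def B_def)
    from has_integral_linear[OF this bounded_linear_inner_right[of B]]
    have "((\<lambda>t. B \<bullet> perp w (v' t)) has_integral B \<bullet> B) {a..b}" by (simp add: o_def)
    with has_integral_mult_right[OF minimizing, of "L + e"]
    have R: "((\<lambda>t. (L + e) * norm (?\<zeta> t) - B \<bullet> perp w (v' t)) has_integral (L + e) * L - B \<bullet> B) {a..b}"
      unfolding L_def by (rule has_integral_diff)
    have "((\<lambda>t. s * ?I t) has_integral s * path_len v w a b z) {a..b}"
      using I by (rule has_integral_mult_right)
    then have "s * path_len v w a b z \<le> (L + e) * L - B \<bullet> B"
    proof (rule has_integral_le[OF _ R])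
      fix t assume t: "t \<in> {a..b}"
      show "s * ?I t \<le> (L + e) * norm (?\<zeta> t) - B \<bullet> perp w (v' t)"
        unfolding s_def using BL e norm_perp_le[OF w, of "v' t"] N(3)[OF t]
        by (intro reverse_Cauchy_Schwarz) auto
    qed
    \<comment> \<open>Enlarging \<open>L\<close> to \<open>L + e\<close> turns the right side into
      \<open>s * s\<close>, so that the positive factor \<open>s\<close> cancels.\<close>
    also have "\<dots> \<le> (L + e) * (L + e) - B \<bullet> B"
      using e by (simp add: L_def mult_left_mono)
    also have "\<dots> = s * s"
      using s(2) by (simp add: power2_norm_eq_inner[symmetric] power2_eq_square)
    finally show ?thesis using s(1) by (simp add: s_def[symmetric])
  qed
  have "((\<lambda>e. sqrt ((L + e)\<^sup>2 - (norm B)\<^sup>2)) \<longlongrightarrow> sqrt ((L + 0)\<^sup>2 - (norm B)\<^sup>2)) (at_right 0)"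
    by (intro tendsto_intros)
  moreover have "\<forall>\<^sub>F e in at_right 0. path_len v w a b z \<le> sqrt ((L + e)\<^sup>2 - (norm B)\<^sup>2)"
    using main by (auto simp: eventually_at_filter)
  ultimately have "path_len v w a b z \<le> sqrt ((L + 0)\<^sup>2 - (norm B)\<^sup>2)"
    by (intro tendsto_lowerbound) auto
  then show ?thesis by (simp add: L_def B_def)
qed

section \<open>Polygons as smooth paths\<close>

lemma has_real_derivative_max_0_squared:
  "((\<lambda>t::real. (max 0 t)\<^sup>2) has_real_derivative 2 * max 0 x) (at x)"
proof (cases x "0 :: real" rule: linorder_cases)
  case less
  have "((\<lambda>_. 0) has_real_derivative 2 * max 0 x) (at x)" using less by simp
  then show ?thesis
    by (rule has_field_derivative_transform_within_open[of _ _ _ "{..<0}"]) (use less in auto)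
next
  case greater
  have "((\<lambda>t. t\<^sup>2) has_real_derivative 2 * max 0 x) (at x)"
    using greater by (auto intro!: derivative_eq_intros)
  then show ?thesis
    by (rule has_field_derivative_transform_within_open[of _ _ _ "{0<..}"]) (use greater in auto)
next
  case equal
  have "((\<lambda>h. (max 0 h)\<^sup>2 / h) \<longlongrightarrow> 0) (at (0::real))"
  proof (rule Lim_null_comparison)
    show "\<forall>\<^sub>F h in at 0. norm ((max 0 h)\<^sup>2 / h) \<le> \<bar>h :: real\<bar>"
      by (intro always_eventually) (auto simp: max_def power2_eq_square)
  qed (auto intro!: tendsto_eq_intros)
  then show ?thesis using equal by (simp add: DERIV_def)
qed

lemma has_real_derivative_shift:
  "(f has_real_derivative D) (at (t - c)) \<Longrightarrow> ((\<lambda>t. f (t - c)) has_real_derivative D) (at t)"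
  using DERIV_shift[of f D t "- c"] by simp

text \<open>A quadratic spline: \<open>2 * t\<^sup>2\<close> up to \<open>1/2\<close>, then
  \<open>1 - 2 * (1 - t)\<^sup>2\<close> up to 1, constant outside. Truncated squares give one
  formula for the whole line; the derivative is a tent vanishing outside the unit interval.\<close>

definition smooth_step :: "real \<Rightarrow> real" where
  "smooth_step t = 2 * (max 0 t)\<^sup>2 - 4 * (max 0 (t - 1/2))\<^sup>2 + 2 * (max 0 (t - 1))\<^sup>2"

definition smooth_step' :: "real \<Rightarrow> real" where
  "smooth_step' t = 4 * max 0 t - 8 * max 0 (t - 1/2) + 4 * max 0 (t - 1)"

lemma smooth_step_deriv: "(smooth_step has_real_derivative smooth_step' t) (at t)"
proof -
  note d = has_real_derivative_max_0_squared
  note d' = has_real_derivative_shift[OF d]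
  show ?thesis
    using DERIV_add[OF DERIV_diff[OF DERIV_cmult[OF d, of 2] DERIV_cmult[OF d'[where c = "1/2"], of 4]]
        DERIV_cmult[OF d'[where c = 1], of 2]]
    unfolding smooth_step_def[abs_def] smooth_step'_def by simp
qed

lemma smooth_step_le_0: "t \<le> 0 \<Longrightarrow> smooth_step t = 0"
  by (simp add: smooth_step_def)

lemma smooth_step_ge_1: "1 \<le> t \<Longrightarrow> smooth_step t = 1"
  by (simp add: smooth_step_def power2_eq_square algebra_simps)

lemma smooth_step'_nonneg: "0 \<le> smooth_step' t"
  by (simp add: smooth_step'_def max_def)

section \<open>Subdividing paths and locality of the length\<close>

lemma C1_path_if_has_vector_derivative:
  assumes z: "\<And>t. (z has_vector_derivative z' t) (at t)" and z': "continuous_on UNIV z'" and ab: "a < b"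
  shows "C1_path a b z"
proof -
  have vd: "vector_derivative z (at t within {a..b}) = z' t" if "t \<in> {a..b}" for t
    using that ab by (intro vector_derivative_at_within_ivl[OF z]) auto
  have "continuous_on {a..b} z'" using z' by (rule continuous_on_subset) simp
  then have "continuous_on {a..b} (\<lambda>t. vector_derivative z (at t within {a..b}))"
    by (rule continuous_on_eq) (simp add: vd)
  moreover have "z differentiable_on {a..b}"
    unfolding differentiable_on_def
    using z differentiableI_vector differentiable_at_withinI by blast
  ultimately show ?thesis by (simp add: C1_path_def)
qed

text \<open>Derivatives are one-sided at the ends of each interval, so the integrands over the whole
  and over the pieces may disagree there, but only at finitely many points.\<close>

lemma path_len_combine:
  fixes v :: "real^'n \<Rightarrow> real^'m"
  assumes w: "norm w = 1" and v: "1-lipschitz_on UNIV v" and ac: "a < c" and cb: "c < b"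
    and z: "C1_path a b z" "C1_path a c z" "C1_path c b z"
  shows "path_len v w a b z = path_len v w a c z + path_len v w c b z"
proof -
  let ?s = "path_speed v w"
  have inner: "at t within {p..q} = at t" if "t \<in> {p..q} - {p, q}" for t p q :: real
    using that by (intro at_within_Icc_at) auto
  have "(?s a b z has_integral path_len v w a c z) {a..c}"
    by (rule has_integral_spike_finite[OF _ _ path_speed_has_integral[OF w ac z(2) v], of "{a, c}"])
      (use ac cb in \<open>auto simp: path_speed_def inner at_within_Icc_at\<close>)
  moreover have "(?s a b z has_integral path_len v w c b z) {c..b}"
    by (rule has_integral_spike_finite[OF _ _ path_speed_has_integral[OF w cb z(3) v], of "{c, b}"])
      (use ac cb in \<open>auto simp: path_speed_def inner at_within_Icc_at\<close>)
  ultimately have "(?s a b z has_integral path_len v w a c z + path_len v w c b z) {a..b}"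
    using ac cb by (intro has_integral_combine[of a c b]) auto
  moreover have "(?s a b z has_integral path_len v w a b z) {a..b}"
    using ac cb by (intro path_speed_has_integral w v z) auto
  ultimately show ?thesis by (meson has_integral_unique)
qed

lemma vector_derivative_within_cong:
  assumes "\<And>s. s \<in> S \<Longrightarrow> f s = g s" "t \<in> S"
  shows "vector_derivative f (at t within S) = vector_derivative g (at t within S)"
proof -
  have "(f has_vector_derivative D) (at t within S) \<longleftrightarrow> (g has_vector_derivative D) (at t within S)" for D
    using assms has_vector_derivative_transform[of t S] by metis
  then show ?thesis by (simp add: vector_derivative_def)
qed

lemma path_len_cong:
  assumes "\<And>t. t \<in> {a..b} \<Longrightarrow> y t = z t"
  shows "path_len v w a b y = path_len v w a b z"
  unfolding path_len_def
proof (rule integral_cong)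
  fix t assume t: "t \<in> {a..b}"
  have "vector_derivative y (at t within {a..b}) = vector_derivative z (at t within {a..b})"
    by (rule vector_derivative_within_cong[OF assms t])
  moreover have "vector_derivative (v \<circ> y) (at t within {a..b}) = vector_derivative (v \<circ> z) (at t within {a..b})"
    by (rule vector_derivative_within_cong[OF _ t]) (simp add: assms)
  ultimately show "sqrt ((norm (vector_derivative y (at t within {a..b})))\<^sup>2
        - (norm (vector_derivative (v \<circ> y) (at t within {a..b})))\<^sup>2
        + (w \<bullet> vector_derivative (v \<circ> y) (at t within {a..b}))\<^sup>2)
      = sqrt ((norm (vector_derivative z (at t within {a..b})))\<^sup>2
        - (norm (vector_derivative (v \<circ> z) (at t within {a..b})))\<^sup>2
        + (w \<bullet> vector_derivative (v \<circ> z) (at t within {a..b}))\<^sup>2)"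
    by simp
qed

text \<open>The function \<open>e\<close> of the overview. The triangle inequality can fail: if
  \<open>perp w \<circ> v\<close> folds a line at a point, the two half-segments there have length 0
  but their union does not. This is why chains are needed.\<close>

definition seg_len :: "(real^'n \<Rightarrow> real^'m) \<Rightarrow> real^'m \<Rightarrow> real^'n \<Rightarrow> real^'n \<Rightarrow> real" where
  "seg_len v w x y = sqrt ((norm (y - x))\<^sup>2 - (norm (perp w (v y - v x)))\<^sup>2)"

text \<open>A relation rather than a function, since many chains join the same points. Growth at the
  far end matches both the gluing of a new edge to a path and the one-segment steps in the
  extension.\<close>

inductive chain_len :: "(real^'n \<Rightarrow> real^'m) \<Rightarrow> real^'m \<Rightarrow> real^'n \<Rightarrow> real^'n \<Rightarrow> real \<Rightarrow> bool"
  for v w x where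
  refl: "chain_len v w x x 0"
| snoc: "chain_len v w x y l \<Longrightarrow> chain_len v w x y' (l + seg_len v w y y')"

text \<open>As \<open>smooth_step'\<close> is nonnegative, the path never turns back, so its
  Euclidean speed integrates to the distance of its ends. The formula for \<open>z\<close> is
  required on one unit interval only, because \<open>z\<close> may be a longer path.\<close>

lemma path_len_smooth_segment:
  fixes v :: "real^'n \<Rightarrow> real^'m"
  assumes w: "norm w = 1" and v: "1-lipschitz_on UNIV v"
    and z: "\<And>t. t \<in> {c..c + 1} \<Longrightarrow> z t = x + smooth_step (t - c) *\<^sub>R (y - x)"
    and C1: "C1_path c (c + 1) z"
  shows "path_len v w c (c + 1) z \<le> seg_len v w x y"
proof -
  have step: "((\<lambda>t. smooth_step (t - c)) has_real_derivative smooth_step' (t - c)) (at t)" for t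
    by (rule has_real_derivative_shift[OF smooth_step_deriv])
  have vd: "vector_derivative z (at t within {c..c+1}) = smooth_step' (t - c) *\<^sub>R (y - x)"
    if t: "t \<in> {c..c+1}" for t
  proof -
    have "((\<lambda>t. x + smooth_step (t - c) *\<^sub>R (y - x)) has_vector_derivative
        smooth_step' (t - c) *\<^sub>R (y - x)) (at t)"
      using step[of t] by (auto intro!: derivative_eq_intros)
    then have "vector_derivative (\<lambda>t. x + smooth_step (t - c) *\<^sub>R (y - x)) (at t within {c..c+1})
        = smooth_step' (t - c) *\<^sub>R (y - x)"
      using t by (intro vector_derivative_at_within_ivl) auto
    then show ?thesis using vector_derivative_within_cong[OF z t] by simp
  qed
  have ends: "z c = x" "z (c + 1) = y"
    using z[of c] z[of "c + 1"] by (simp_all add: smooth_step_le_0 smooth_step_ge_1)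
  have "((\<lambda>t. smooth_step' (t - c)) has_integral smooth_step (c + 1 - c) - smooth_step (c - c)) {c..c+1}"
    by (rule fundamental_theorem_of_calculus)
      (auto intro!: has_vector_derivative_at_within step[unfolded has_real_derivative_iff_has_vector_derivative])
  then have "((\<lambda>t. smooth_step' (t - c)) has_integral 1) {c..c+1}"
    by (simp add: smooth_step_le_0 smooth_step_ge_1)
  from has_integral_mult_left[OF this, of "norm (y - x)"]
  have "((\<lambda>t. smooth_step' (t - c) * norm (y - x)) has_integral norm (z (c + 1) - z c)) {c..c+1}"
    by (simp add: ends)
  then have "((\<lambda>t. norm (vector_derivative z (at t within {c..c+1}))) has_integral norm (z (c + 1) - z c)) {c..c+1}"
    by (rule has_integral_spike_finite[of "{}", rotated 2]) (auto simp: vd smooth_step'_nonneg)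
  from path_len_le_if_minimizing[OF w _ C1 v this] show ?thesis
    by (simp add: ends seg_len_def)
qed

text \<open>
  Stopping smoothly at its vertices, a polygon becomes a \<open>C\<^sup>1\<close> path; being constant
  outside \<open>{0..b}\<close>, it is extended by simply adding a multiple of the next edge.
\<close>
lemma chain_len_imp_path:
  fixes v :: "real^'n \<Rightarrow> real^'m"
  assumes w: "norm w = 1" and v: "1-lipschitz_on UNIV v" and "chain_len v w x y l"
  shows "\<exists>z z' b. 0 < b \<and> (\<forall>t. (z has_vector_derivative z' t) (at t)) \<and> continuous_on UNIV z' \<and>
    (\<forall>t\<le>0. z t = x) \<and> (\<forall>t\<ge>b. z t = y) \<and> path_len v w 0 b z \<le> l"
  using assms(3)
proof induction
  case refl
  \<comment> \<open>Parameter intervals are nondegenerate, so the trivial chain becomes a constant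
    path over a unit interval, seen as a segment from \<open>x\<close> to \<open>x\<close>.\<close>
  have "path_len v w 0 (0 + 1) (\<lambda>_. x) \<le> seg_len v w x x"
    by (intro path_len_smooth_segment w v C1_path_if_has_vector_derivative[of _ "\<lambda>_. 0"]) auto
  moreover have "seg_len v w x x = 0" by (simp add: seg_len_def perp_def)
  ultimately show ?case
    by (intro exI[of _ "\<lambda>_. x"] exI[of _ "\<lambda>_. 0"] exI[of _ 1]) auto
next
  case (snoc y l y')
  then obtain z z' b where z: "0 < b" "\<And>t. (z has_vector_derivative z' t) (at t)" "continuous_on UNIV z'"
    "\<And>t. t \<le> 0 \<Longrightarrow> z t = x" "\<And>t. b \<le> t \<Longrightarrow> z t = y" "path_len v w 0 b z \<le> l"
    by blast
  define p where "p = (\<lambda>t. z t + smooth_step (t - b) *\<^sub>R (y' - y))"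
  define p' where "p' = (\<lambda>t. z' t + smooth_step' (t - b) *\<^sub>R (y' - y))"
  have step: "((\<lambda>t. smooth_step (t - b)) has_real_derivative smooth_step' (t - b)) (at t)" for t
    by (rule has_real_derivative_shift[OF smooth_step_deriv])
  have pd: "(p has_vector_derivative p' t) (at t)" for t
    unfolding p_def p'_def using z(2)[of t] step[of t] by (auto intro!: derivative_eq_intros)
  have p'c: "continuous_on UNIV p'"
    unfolding p'_def smooth_step'_def by (intro continuous_intros z(3))
  have C1: "C1_path c d p" if "c < d" for c d
    by (rule C1_path_if_has_vector_derivative[OF pd p'c that])
  have pz: "p t = z t" if "t \<le> b" for t
    using that by (simp add: p_def smooth_step_le_0)
  have "path_len v w 0 (b + 1) p = path_len v w 0 b p + path_len v w b (b + 1) p"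
    using z(1) by (intro path_len_combine w v C1) auto
  also have "path_len v w 0 b p = path_len v w 0 b z"
    by (rule path_len_cong) (simp add: pz)
  also have "path_len v w b (b + 1) p \<le> seg_len v w y y'"
    by (rule path_len_smooth_segment[OF w v _ C1]) (simp_all add: p_def z(5))
  finally have "path_len v w 0 (b + 1) p \<le> l + seg_len v w y y'"
    using z(6) by simp
  moreover have "p t = x" if "t \<le> 0" for t
    using that z(1,4) pz[of t] by simp
  moreover have "p t = y'" if "b + 1 \<le> t" for t
    using that z(5)[of t] by (simp add: p_def smooth_step_ge_1)
  ultimately show ?case
    using z(1) pd p'c by (intro exI[of _ p] exI[of _ p'] exI[of _ "b + 1"]) auto
qed

lemma path_dist_le_chain_len:
  fixes v :: "real^'n \<Rightarrow> real^'m"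
  assumes w: "norm w = 1" and v: "1-lipschitz_on UNIV v" and c: "chain_len v w x y l"
  shows "path_dist v w x y \<le> l"
proof -
  obtain z z' b where z: "0 < b" "\<And>t. (z has_vector_derivative z' t) (at t)" "continuous_on UNIV z'"
    "\<And>t. t \<le> 0 \<Longrightarrow> z t = x" "\<And>t. b \<le> t \<Longrightarrow> z t = y" "path_len v w 0 b z \<le> l"
    using chain_len_imp_path[OF w v c] by blast
  have "path_dist v w x y \<le> path_len v w 0 b z"
    unfolding path_dist_def
  proof (rule cInf_lower)
    show "path_len v w 0 b z \<in> {path_len v w a b z |a b z. a < b \<and> C1_path a b z \<and> z a = x \<and> z b = y}"
      using z C1_path_if_has_vector_derivative[OF z(2,3,1)] by blast
    show "bdd_below {path_len v w a b z |a b z. a < b \<and> C1_path a b z \<and> z a = x \<and> z b = y}"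
      using path_len_nonneg[OF w _ _ v] by (intro bdd_belowI[of _ 0]) blast
  qed
  with z(6) show ?thesis by simp
qed

lemma seg_len_commute: "seg_len v w x y = seg_len v w y x"
  by (simp add: seg_len_def perp_diff norm_minus_commute)

lemma abs_inner_diff_le_seg_len:
  fixes v :: "real^'n \<Rightarrow> real^'m"
  assumes w: "norm w = 1" and v: "1-lipschitz_on UNIV v"
  shows "\<bar>w \<bullet> v x - w \<bullet> v y\<bar> \<le> seg_len v w x y"
proof -
  have "(w \<bullet> (v x - v y))\<^sup>2 = (norm (v x - v y))\<^sup>2 - (norm (perp w (v x - v y)))\<^sup>2"
    by (simp add: norm_perp[OF w])
  also have "\<dots> \<le> (norm (x - y))\<^sup>2 - (norm (perp w (v x - v y)))\<^sup>2"
    using lipschitz_onD[OF v, of x y] by (simp add: dist_norm power_mono)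
  finally have "\<bar>w \<bullet> (v x - v y)\<bar> \<le> seg_len v w y x"
    unfolding seg_len_def by (rule real_le_rsqrt[of "\<bar>_\<bar>", unfolded power2_abs])
  then show ?thesis by (simp add: inner_diff_right seg_len_commute[of v w x])
qed

section \<open>The extension\<close>

text \<open>McShane's formula, with chains of segments in place of a metric.\<close>
lemma chain_len_extension:
  fixes f :: "real^'n \<Rightarrow> real"
  assumes f: "\<And>x y l. x \<in> A \<Longrightarrow> y \<in> A \<Longrightarrow> chain_len v w x y l \<Longrightarrow> f y - f x \<le> l" and "A \<noteq> {}"
  obtains F where "\<And>x. x \<in> A \<Longrightarrow> F x = f x" "\<And>x y. \<bar>F x - F y\<bar> \<le> seg_len v w x y"
proof -
  define X where "X = (\<lambda>x. {f a + l | a l. a \<in> A \<and> chain_len v w a x l})"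
  obtain a0 where a0: "a0 \<in> A" using \<open>A \<noteq> {}\<close> by blast
  have ne: "X x \<noteq> {}" for x
    using chain_len.snoc[OF chain_len.refl[of v w a0], of x] a0 by (auto simp: X_def)
  have bdd: "bdd_below (X x)" for x
  proof (rule bdd_belowI)
    fix r assume "r \<in> X x"
    then obtain a l where "r = f a + l" "a \<in> A" "chain_len v w a x l" by (auto simp: X_def)
    \<comment> \<open>Closing the chain by a segment from \<open>x\<close> to \<open>a0\<close>
      gives a chain between points of \<open>A\<close>, to which the hypothesis on \<open>f\<close>
      applies.\<close>
    then show "f a0 - seg_len v w x a0 \<le> r"
      using f[OF _ a0 chain_len.snoc[of v w a x l a0]] by auto
  qed
  define F where "F = (\<lambda>x. Inf (X x))"
  have F_le: "F y \<le> F x + seg_len v w x y" for x y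
  proof -
    have "F y - seg_len v w x y \<le> r" if "r \<in> X x" for r
    proof -
      have "r + seg_len v w x y \<in> X y"
        using that by (force simp: X_def intro: chain_len.snoc)
      from cInf_lower[OF this bdd] show ?thesis by (simp add: F_def)
    qed
    then have "F y - seg_len v w x y \<le> Inf (X x)" by (rule cInf_greatest[OF ne])
    then show ?thesis by (simp add: F_def)
  qed
  show ?thesis
  proof (rule that[of F])
    show "\<bar>F x - F y\<bar> \<le> seg_len v w x y" for x y
      using F_le[of x y] F_le[of y x] by (simp add: seg_len_commute[of v w y])
    show "F x = f x" if x: "x \<in> A" for x
    proof (rule antisym)
      have "f x \<in> X x" using chain_len.refl[of v w x] x by (force simp: X_def)
      then show "F x \<le> f x" unfolding F_def by (rule cInf_lower[OF _ bdd])
      show "f x \<le> F x"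
        unfolding F_def using f[OF _ x] by (intro cInf_greatest[OF ne]) (fastforce simp: X_def)
    qed
  qed
qed

lemma abs_max_diff_le:
  fixes a b c d s :: real
  shows "\<bar>a - c\<bar> \<le> s \<Longrightarrow> \<bar>b - d\<bar> \<le> s \<Longrightarrow> \<bar>max a b - max c d\<bar> \<le> s"
  by (auto simp: max_def)

lemma abs_min_diff_le:
  fixes a b c d s :: real
  shows "\<bar>a - c\<bar> \<le> s \<Longrightarrow> \<bar>b - d\<bar> \<le> s \<Longrightarrow> \<bar>min a b - min c d\<bar> \<le> s"
  by (auto simp: min_def)

theorem mainTheorem6:
  fixes v u :: "real^'n \<Rightarrow> real^'m"
    and w :: "real^'m"
    and A :: "(real^'n) set"
  assumes "norm w = 1"
    and "1-lipschitz_on UNIV v"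
    and "geodesically_convex v w A"
    and "1-lipschitz_on A u"
    and "\<And>x. x \<in> A \<Longrightarrow> v x - u x \<in> span {w}"
  shows "\<exists>u' :: real^'n \<Rightarrow> real^'m.
           1-lipschitz_on UNIV u' \<and>
           (\<forall>x\<in>A. u' x = u x) \<and>
           (SUP x. ennreal (norm (v x - u' x))) = (SUP x\<in>A. ennreal (norm (v x - u x)))"
proof (cases "A = {}")
  case True
  \<comment> \<open>The supremum over the empty set is 0, so the extension has to be
    \<open>v\<close> itself.\<close>
  then show ?thesis using assms(2) by (intro exI[of _ v]) (simp add: bot_ennreal)
next
  case False
  note w = assms(1) and v = assms(2)
  have ww: "w \<bullet> w = 1" using w by (simp add: norm_eq_sqrt_inner)
  have uv: "perp w (v x) = perp w (u x)" if "x \<in> A" for x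
    by (rule perp_eq_if_diff_in_span[OF w assms(5)[OF that]])
  have f: "w \<bullet> u y - w \<bullet> u x \<le> l" if xy: "x \<in> A" "y \<in> A" and c: "chain_len v w x y l" for x y l
  proof -
    obtain a b z where z: "a < b" "C1_path a b z" "z a = x" "z b = y" "z ` {a..b} \<subseteq> A"
      "path_len v w a b z = path_dist v w x y"
      using assms(3) xy unfolding geodesically_convex_def by blast
    have "w \<bullet> u (z b) - w \<bullet> u (z a) \<le> path_len v w a b z"
      by (rule inner_diff_le_path_len[OF w z(1,2,5) v assms(4) uv])
    also have "\<dots> \<le> l" unfolding z(6) by (rule path_dist_le_chain_len[OF w v c])
    finally show ?thesis by (simp add: z)
  qed
  obtain F where F: "\<And>x. x \<in> A \<Longrightarrow> F x = w \<bullet> u x" "\<And>x y. \<bar>F x - F y\<bar> \<le> seg_len v w x y"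
  proof (rule chain_len_extension[of A v w "\<lambda>x. w \<bullet> u x"])
    show "w \<bullet> u y - w \<bullet> u x \<le> l" if "x \<in> A" "y \<in> A" "chain_len v w x y l" for x y l
      by (rule f[OF that])
    show "A \<noteq> {}" by (rule False)
  qed (rule that)
  have "\<exists>G. (\<forall>x\<in>A. G x = w \<bullet> u x) \<and> (\<forall>x y. \<bar>G x - G y\<bar> \<le> seg_len v w x y) \<and>
      (\<forall>x. ennreal \<bar>w \<bullet> v x - G x\<bar> \<le> (SUP x\<in>A. ennreal (norm (v x - u x))))"
  \<comment> \<open>An infinite supremum imposes no bound, so \<open>F\<close> serves
    unclipped.\<close>
  proof (cases "SUP x\<in>A. ennreal (norm (v x - u x))")
    case top
    show ?thesis unfolding top using F by (intro exI[of _ F]) auto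
  next
    case (real C)
    define G where "G = (\<lambda>x. max (w \<bullet> v x - C) (min (w \<bullet> v x + C) (F x)))"
    \<comment> \<open>On \<open>A\<close> the clipping is inactive: \<open>w \<bullet> v x\<close>
      and \<open>w \<bullet> u x\<close> differ by at most \<open>norm (v x - u x)\<close>, hence by
      at most \<open>C\<close>.\<close>
    have "G x = w \<bullet> u x" if x: "x \<in> A" for x
    proof -
      have "ennreal (norm (v x - u x)) \<le> ennreal C"
        using SUP_upper[OF x, of "\<lambda>x. ennreal (norm (v x - u x))"] real by simp
      then have "norm (v x - u x) \<le> C" using real by (simp add: ennreal_le_iff)
      then have "\<bar>w \<bullet> (v x - u x)\<bar> \<le> C"
        using Cauchy_Schwarz_ineq2[of w "v x - u x"] w by simp
      then show ?thesis using F(1)[OF x] by (auto simp: G_def inner_diff_right)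
    qed
    moreover have "\<bar>G x - G y\<bar> \<le> seg_len v w x y" for x y
      unfolding G_def using F(2)[of x y] abs_inner_diff_le_seg_len[OF w v, of x y]
      by (intro abs_max_diff_le abs_min_diff_le) simp_all
    moreover have "\<bar>w \<bullet> v x - G x\<bar> \<le> C" for x
      using real by (auto simp: G_def max_def min_def)
    ultimately show ?thesis using real by (intro exI[of _ G]) (auto simp: ennreal_leI)
  qed
  then obtain G where G: "\<And>x. x \<in> A \<Longrightarrow> G x = w \<bullet> u x" "\<And>x y. \<bar>G x - G y\<bar> \<le> seg_len v w x y"
    "\<And>x. ennreal \<bar>w \<bullet> v x - G x\<bar> \<le> (SUP x\<in>A. ennreal (norm (v x - u x)))" by blast
  \<comment> \<open>Keeping the projection of \<open>v\<close> makes \<open>v x - u' x\<close> a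
    multiple of \<open>w\<close> of norm \<open>\<bar>w \<bullet> v x - G x\<bar>\<close>, so
    \<open>G\<close> alone controls the supremum.\<close>
  define u' where "u' = (\<lambda>x. perp w (v x) + G x *\<^sub>R w)"
  have perp0: "w \<bullet> perp w y = 0" for y by (simp add: perp_def inner_diff_right ww)
  have perpu': "perp w (u' x) = perp w (v x)" for x
    by (simp add: perp_def u'_def inner_diff_right inner_add_right ww)
  have wu': "w \<bullet> u' x = G x" for x
    by (simp add: u'_def inner_add_right perp0 ww)
  have u'A: "u' x = u x" if "x \<in> A" for x
    using that by (simp add: u'_def uv G) (simp add: perp_def)
  have "1-lipschitz_on UNIV u'"
  proof (rule lipschitz_onI)
    fix x y
    have "(norm (u' x - u' y))\<^sup>2 = (norm (perp w (v x - v y)))\<^sup>2 + (G x - G y)\<^sup>2"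
      using norm_perp[OF w, of "u' x - u' y"]
      by (simp add: perp_diff perpu' inner_diff_right wu')
    also have "\<dots> \<le> (norm (perp w (v x - v y)))\<^sup>2 + (seg_len v w y x)\<^sup>2"
      using G(2)[of x y] by (simp add: abs_le_square_iff[symmetric] seg_len_commute[of v w y])
    also have "(seg_len v w y x)\<^sup>2 = (norm (x - y))\<^sup>2 - (norm (perp w (v x - v y)))\<^sup>2"
    proof -
      have "norm (perp w (v x - v y)) \<le> norm (x - y)"
        using norm_perp_le[OF w, of "v x - v y"] lipschitz_onD[OF v, of x y] by (simp add: dist_norm)
      then show ?thesis by (simp add: seg_len_def power_mono)
    qed
    finally have "(norm (u' x - u' y))\<^sup>2 \<le> (norm (x - y))\<^sup>2" by simp
    then have "norm (u' x - u' y) \<le> norm (x - y)" by (rule power2_le_imp_le) simp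
    then show "dist (u' x) (u' y) \<le> 1 * dist x y" by (simp add: dist_norm)
  qed simp
  moreover have "(SUP x. ennreal (norm (v x - u' x))) = (SUP x\<in>A. ennreal (norm (v x - u x)))"
  proof (rule antisym)
    show "(SUP x. ennreal (norm (v x - u' x))) \<le> (SUP x\<in>A. ennreal (norm (v x - u x)))"
    proof (rule SUP_least)
      fix x
      have "v x - u' x = (w \<bullet> v x - G x) *\<^sub>R w"
        by (simp add: u'_def perp_def algebra_simps)
      then have "norm (v x - u' x) = \<bar>w \<bullet> v x - G x\<bar>" using w by simp
      then show "ennreal (norm (v x - u' x)) \<le> (SUP x\<in>A. ennreal (norm (v x - u x)))"
        using G(3)[of x] by simp
    qed
    show "(SUP x\<in>A. ennreal (norm (v x - u x))) \<le> (SUP x. ennreal (norm (v x - u' x)))"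
      by (rule SUP_mono) (auto simp: u'A[symmetric])
  qed
  ultimately show ?thesis using u'A by (intro exI[of _ u'] conjI ballI)
qed

end
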